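(* Let $G$ be a connected finite or infinite and countable weighted graph with Laplacian $\mathcal{L}$ as in the context. Suppose that $\Xi=\{\Omega_j\}$ is a disjoint cover of $V(G)$ by connected and finite subgraphs $\Omega_j$ (each with more than one vertex), let $\lambda_{1,j}$ be the first nonzero eigenvalue of the Laplacian of the induced graph $\Omega_j$, and assume $\Lambda_\Xi=\inf_j\lambda_{1,j}>0$. Let $\alpha>0$ and $\omega>0$ satisfy $$\gamma=\frac{1+\alpha}{\alpha}\frac{\omega}{\Lambda_\Xi}<1 .$$ Then any function $f\in PW_\omega(\mathcal{L})$ can be reconstructed from the set of its averages $\{\langle f,\xi_j\rangle\}$, $\xi_j=|\Omega_j|^{-1/2}\chi_{\Omega_j}$, by the formula $$f=\lim_{k\to\infty}S_k(f),\qquad k=2^l,\ l=0,1,\dots,$$ (limit in $L_2(G)$), with the error estimate $$\|f-S_k(f)\|\le2\gamma^k\|f\|,\qquad k=2^l,\ l=0,1,\dots.$$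
   Context: $G$ is an undirected weighted graph with vertex set $V(G)$ and weight function $w:V(G)\times V(G)\to[0,\infty)$, $w(u,v)=w(v,u)$, $w(u,u)=0$; edges are the pairs with $w(u,v)\ne0$. If $G$ is infinite, the degrees are assumed uniformly bounded: $\sum_{u}w(u,v)\le c$ for all $v$ and some constant $c$. $L_2(G)$ is the Hilbert space of complex functions on $V(G)$ with $\langle f,g\rangle=\sum_vf(v)\overline{g(v)}$ and finite norm. $\mathcal{L}$ is the bounded non-negative self-adjoint operator $(\mathcal{L}f)(v)=\sum_{u\in V(G)}(f(v)-f(u))w(v,u)$ on $L_2(G)$. The induced graph on $\Omega\subset V(G)$ has vertex set $\Omega$ and all edges of $G$ with both ends in $\Omega$, with weights the restriction of $w$; its Laplacian is given by the same formula with $V(G)$ replaced by $\Omega$. $|\Omega|$ is the number of vertices of $\Omega$, $\chi_\Omega$ its characteristic function. $PW_\omega(\mathcal{L})$ is the range of the spectral projector $\mathbf{1}_{[0,\omega]}(\mathcal{L})$; on it $\|\mathcal{L}^{s/2}f\|\le\omega^{s/2}\|f\|$ for $s\ge0$. Interpolating variational spline: for $f\in L_2(G)$ and $k\ge1$, $S_k(f)$ is the unique minimizer of $u\mapsto\|\mathcal{L}^{k/2}u\|$ among all $u\in L_2(G)$ with $\langle u,\xi_j\rangle=\langle f,\xi_j\rangle$ for all $j$. *)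

theory Defs
  imports "HOL-Analysis.Analysis"
begin

text \<open>
  A weighted graph is given by a vertex set \<open>V\<close> and a weight function \<open>w\<close>; only the values of
  \<open>w\<close> on \<open>V \<times> V\<close> matter. The graph induced on \<open>\<Omega> \<subseteq> V\<close> is the pair of \<open>\<Omega>\<close> and the same \<open>w\<close>.
\<close>

definition weighted_graph :: "'v set \<Rightarrow> ('v \<Rightarrow> 'v \<Rightarrow> real) \<Rightarrow> bool" where
  "weighted_graph V w \<longleftrightarrow>
     (\<forall>u\<in>V. \<forall>v\<in>V. 0 \<le> w u v \<and> w u v = w v u) \<and> (\<forall>v\<in>V. w v v = 0)"

definition bounded_degrees :: "'v set \<Rightarrow> ('v \<Rightarrow> 'v \<Rightarrow> real) \<Rightarrow> bool" where
  "bounded_degrees V w \<longleftrightarrow>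
     (\<exists>c. \<forall>v\<in>V. (\<lambda>u. w u v) summable_on V \<and> (\<Sum>\<^sub>\<infinity>u\<in>V. w u v) \<le> c)"

definition edges :: "'v set \<Rightarrow> ('v \<Rightarrow> 'v \<Rightarrow> real) \<Rightarrow> ('v \<times> 'v) set" where
  "edges V w = {(u, v). u \<in> V \<and> v \<in> V \<and> w u v \<noteq> 0}"

definition graph_connected :: "'v set \<Rightarrow> ('v \<Rightarrow> 'v \<Rightarrow> real) \<Rightarrow> bool" where
  "graph_connected V w \<longleftrightarrow> V \<noteq> {} \<and> (\<forall>u\<in>V. \<forall>v\<in>V. (u, v) \<in> (edges V w)\<^sup>*)"

text \<open>
  Functions on \<open>V\<close> are represented by functions on the whole type that vanish outside \<open>V\<close>, so that
  equality of elements of \<open>L2 V\<close> is equality of functions.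
\<close>

definition L2 :: "'v set \<Rightarrow> ('v \<Rightarrow> complex) set" where
  "L2 V = {f. (\<forall>v. v \<notin> V \<longrightarrow> f v = 0) \<and> (\<lambda>v. (cmod (f v))\<^sup>2) summable_on V}"

definition L2_inner :: "'v set \<Rightarrow> ('v \<Rightarrow> complex) \<Rightarrow> ('v \<Rightarrow> complex) \<Rightarrow> complex" where
  "L2_inner V f g = (\<Sum>\<^sub>\<infinity>v\<in>V. f v * cnj (g v))"

definition L2_norm :: "'v set \<Rightarrow> ('v \<Rightarrow> complex) \<Rightarrow> real" where
  "L2_norm V f = sqrt (\<Sum>\<^sub>\<infinity>v\<in>V. (cmod (f v))\<^sup>2)"

definition L2_tendsto :: "'v set \<Rightarrow> (nat \<Rightarrow> 'v \<Rightarrow> complex) \<Rightarrow> ('v \<Rightarrow> complex) \<Rightarrow> bool" where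
  "L2_tendsto V s f \<longleftrightarrow>
     (\<forall>n. s n \<in> L2 V) \<and> f \<in> L2 V \<and> (\<lambda>n. L2_norm V (\<lambda>v. f v - s n v)) \<longlonglongrightarrow> 0"

definition laplacian ::
    "'v set \<Rightarrow> ('v \<Rightarrow> 'v \<Rightarrow> real) \<Rightarrow> ('v \<Rightarrow> complex) \<Rightarrow> 'v \<Rightarrow> complex" where
  "laplacian V w f v =
     (if v \<in> V then \<Sum>\<^sub>\<infinity>u\<in>V. (f v - f u) * complex_of_real (w v u) else 0)"

definition laplacian_eigenvalue :: "'v set \<Rightarrow> ('v \<Rightarrow> 'v \<Rightarrow> real) \<Rightarrow> real \<Rightarrow> bool" where
  "laplacian_eigenvalue V w \<mu> \<longleftrightarrow>
     (\<exists>f\<in>L2 V. f \<noteq> (\<lambda>v. 0) \<and> laplacian V w f = (\<lambda>v. complex_of_real \<mu> * f v))"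

definition first_nonzero_eigenvalue :: "'v set \<Rightarrow> ('v \<Rightarrow> 'v \<Rightarrow> real) \<Rightarrow> real" where
  "first_nonzero_eigenvalue V w = (LEAST \<mu>. laplacian_eigenvalue V w \<mu> \<and> \<mu> \<noteq> 0)"


text \<open>
  An operator on \<open>L2 V\<close> is represented by a map on all functions of which only the restriction to
  \<open>L2 V\<close> is significant.
\<close>

definition bounded_operator ::
    "'v set \<Rightarrow> (('v \<Rightarrow> complex) \<Rightarrow> 'v \<Rightarrow> complex) \<Rightarrow> bool" where
  "bounded_operator V T \<longleftrightarrow>
     (\<forall>f\<in>L2 V. T f \<in> L2 V) \<and>
     (\<forall>f\<in>L2 V. \<forall>g\<in>L2 V. \<forall>a b. T (\<lambda>v. a * f v + b * g v) = (\<lambda>v. a * T f v + b * T g v)) \<and>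
     (\<exists>C. \<forall>f\<in>L2 V. L2_norm V (T f) \<le> C * L2_norm V f)"

definition selfadjoint_operator ::
    "'v set \<Rightarrow> (('v \<Rightarrow> complex) \<Rightarrow> 'v \<Rightarrow> complex) \<Rightarrow> bool" where
  "selfadjoint_operator V T \<longleftrightarrow> bounded_operator V T \<and>
     (\<forall>f\<in>L2 V. \<forall>g\<in>L2 V. L2_inner V (T f) g = L2_inner V f (T g))"

definition nonneg_selfadjoint_operator ::
    "'v set \<Rightarrow> (('v \<Rightarrow> complex) \<Rightarrow> 'v \<Rightarrow> complex) \<Rightarrow> bool" where
  "nonneg_selfadjoint_operator V T \<longleftrightarrow> selfadjoint_operator V T \<and>
     (\<forall>f\<in>L2 V. 0 \<le> Re (L2_inner V (T f) f))"

definition orthogonal_projection ::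
    "'v set \<Rightarrow> (('v \<Rightarrow> complex) \<Rightarrow> 'v \<Rightarrow> complex) \<Rightarrow> bool" where
  "orthogonal_projection V P \<longleftrightarrow> selfadjoint_operator V P \<and> (\<forall>f\<in>L2 V. P (P f) = P f)"

text \<open>
  Projection-valued Borel measures on the real line. For a bounded self-adjoint operator \<open>T\<close>,
  the spectral theorem provides exactly one (as far as the values on \<open>L2 V\<close> are concerned) with
  \<open>T = \<integral> t dE(t)\<close>, the integral being understood weakly; on a complex Hilbert space the
  quadratic form determines the operator, so the diagonal \<open>\<langle>T f, f\<rangle>\<close> suffices.
\<close>

definition projection_valued_measure ::
    "'v set \<Rightarrow> (real set \<Rightarrow> ('v \<Rightarrow> complex) \<Rightarrow> 'v \<Rightarrow> complex) \<Rightarrow> bool" where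
  "projection_valued_measure V E \<longleftrightarrow>
     (\<forall>B\<in>sets borel. orthogonal_projection V (E B)) \<and>
     (\<forall>f\<in>L2 V. E UNIV f = f) \<and>
     (\<forall>A\<in>sets borel. \<forall>B\<in>sets borel. \<forall>f\<in>L2 V. E (A \<inter> B) f = E A (E B f)) \<and>
     (\<forall>f\<in>L2 V. measure_space UNIV (sets borel) (\<lambda>B. ennreal (Re (L2_inner V (E B f) f))))"

definition scalar_measure ::
    "'v set \<Rightarrow> (real set \<Rightarrow> ('v \<Rightarrow> complex) \<Rightarrow> 'v \<Rightarrow> complex) \<Rightarrow> ('v \<Rightarrow> complex) \<Rightarrow> real measure" where
  "scalar_measure V E f =
     measure_of UNIV (sets borel) (\<lambda>B. ennreal (Re (L2_inner V (E B f) f)))"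

definition spectral_measure ::
    "'v set \<Rightarrow> (('v \<Rightarrow> complex) \<Rightarrow> 'v \<Rightarrow> complex) \<Rightarrow>
     (real set \<Rightarrow> ('v \<Rightarrow> complex) \<Rightarrow> 'v \<Rightarrow> complex) \<Rightarrow> bool" where
  "spectral_measure V T E \<longleftrightarrow> projection_valued_measure V E \<and>
     (\<forall>f\<in>L2 V. integrable (scalar_measure V E f) (\<lambda>t. t) \<and>
        L2_inner V (T f) f = complex_of_real (\<integral>t. t \<partial>scalar_measure V E f))"

text \<open>The spectral projector \<open>1\<^bsub>[0,\<omega>]\<^esub>(T)\<close> is \<open>E {0..\<omega>}\<close> for the spectral measure \<open>E\<close> of \<open>T\<close>.\<close>

definition paley_wiener ::
    "'v set \<Rightarrow> (('v \<Rightarrow> complex) \<Rightarrow> 'v \<Rightarrow> complex) \<Rightarrow> real \<Rightarrow> ('v \<Rightarrow> complex) set" where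
  "paley_wiener V T \<omega> = {f. \<exists>E. spectral_measure V T E \<and> f \<in> E {0..\<omega>} ` L2 V}"

text \<open>
  The non-negative square root of a non-negative self-adjoint operator exists and is unique on
  \<open>L2 V\<close>; its values outside \<open>L2 V\<close> are irrelevant, whence the choice operator.
\<close>

definition operator_sqrt ::
    "'v set \<Rightarrow> (('v \<Rightarrow> complex) \<Rightarrow> 'v \<Rightarrow> complex) \<Rightarrow> ('v \<Rightarrow> complex) \<Rightarrow> 'v \<Rightarrow> complex" where
  "operator_sqrt V T =
     (SOME R. nonneg_selfadjoint_operator V R \<and> (\<forall>f\<in>L2 V. R (R f) = T f))"

definition half_power ::
    "'v set \<Rightarrow> (('v \<Rightarrow> complex) \<Rightarrow> 'v \<Rightarrow> complex) \<Rightarrow> nat \<Rightarrow>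
     ('v \<Rightarrow> complex) \<Rightarrow> 'v \<Rightarrow> complex" where \<comment> \<open>\<open>T\<close> to the power \<open>k/2\<close>\<close>
  "half_power V T k = operator_sqrt V T ^^ k"


definition normalized_indicator :: "'v set \<Rightarrow> 'v \<Rightarrow> complex" where
  "normalized_indicator \<Omega> v = complex_of_real (real (card \<Omega>) powr (-1/2)) * indicator \<Omega> v"

definition interpolates ::
    "'v set \<Rightarrow> 'v set set \<Rightarrow> ('v \<Rightarrow> complex) \<Rightarrow> ('v \<Rightarrow> complex) \<Rightarrow> bool" where
  "interpolates V \<Xi> f u \<longleftrightarrow> u \<in> L2 V \<and>
     (\<forall>\<Omega>\<in>\<Xi>. L2_inner V u (normalized_indicator \<Omega>) = L2_inner V f (normalized_indicator \<Omega>))"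

definition is_variational_spline ::
    "'v set \<Rightarrow> ('v \<Rightarrow> 'v \<Rightarrow> real) \<Rightarrow> 'v set set \<Rightarrow> nat \<Rightarrow> ('v \<Rightarrow> complex) \<Rightarrow> ('v \<Rightarrow> complex) \<Rightarrow> bool" where
  "is_variational_spline V w \<Xi> k f s \<longleftrightarrow> interpolates V \<Xi> f s \<and>
     (\<forall>u. interpolates V \<Xi> f u \<longrightarrow>
        L2_norm V (half_power V (laplacian V w) k s) \<le> L2_norm V (half_power V (laplacian V w) k u))"

definition variational_spline ::
    "'v set \<Rightarrow> ('v \<Rightarrow> 'v \<Rightarrow> real) \<Rightarrow> 'v set set \<Rightarrow> nat \<Rightarrow> ('v \<Rightarrow> complex) \<Rightarrow> 'v \<Rightarrow> complex" where
  "variational_spline V w \<Xi> k f = (THE s. is_variational_spline V w \<Xi> k f s)"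

end

theory Submission
  imports Defs
begin

text \<open>
  The error \<open>g = f - S\<^sub>k(f)\<close> has zero average on every \<open>\<Omega>\<^sub>j\<close>, so the Poincare inequalities of the
  finite graphs \<open>\<Omega>\<^sub>j\<close> add up to \<open>\<Lambda> \<parallel>g\<parallel>\<^sup>2 \<le> \<langle>\<L> g, g\<rangle> = \<parallel>R g\<parallel>\<^sup>2\<close> with \<open>R\<close> the square root of \<open>\<L>\<close>.
  Repeated squaring turns this into \<open>\<Lambda>\<^sup>k \<parallel>g\<parallel>\<^sup>2 \<le> \<parallel>R\<^sup>k g\<parallel>\<^sup>2\<close> for \<open>k = 2\<^sup>l\<close>. This coercivity makes the
  spline exist, and it is orthogonal to \<open>g\<close> in the form \<open>\<langle>R\<^sup>k u, R\<^sup>k v\<rangle>\<close>; hence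
  \<open>\<parallel>R\<^sup>k g\<parallel>\<^sup>2 = \<langle>R\<^sup>k f, R\<^sup>k g\<rangle> = \<langle>\<L>\<^sup>k f, g\<rangle> \<le> \<omega>\<^sup>k \<parallel>f\<parallel> \<parallel>g\<parallel>\<close>, and \<open>\<parallel>g\<parallel> \<le> (\<omega> / \<Lambda>)\<^sup>k \<parallel>f\<parallel>\<close>.
\<close>

section \<open>Square roots of non-negative self-adjoint operators\<close>

text \<open>Applying R destroys the zero averages in general, so the Poincare inequality cannot be
  composed with itself. Only the exponent at the fixed vector \<open>x\<close> can be raised: move
  half of the factors across the inner product, apply Cauchy-Schwarz and cancel one
  \<open>norm x\<close>. Each such move doubles the exponent, whence the restriction to k = 2^l.

  Two objects are given only indirectly. The half powers are built on a root picked by a choice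
  operator, so a non-negative root must first be constructed, complex linear and mapping
  \<open>L2 V\<close> into itself; the construction runs in a real Hilbert space, and a commutation
  clause restores these two properties. The spectral measure is tied to the Laplacian only through
  the numbers <L f, f>, so even the invariance of a spectral subspace under L has to be extracted
  from quadratic forms before the bound \<omega>^k on the k-th power of L can be iterated.\<close>

definition selfadjoint :: "('a::real_inner \<Rightarrow> 'a) \<Rightarrow> bool" where
  "selfadjoint T \<longleftrightarrow> bounded_linear T \<and> (\<forall>x y. inner (T x) y = inner x (T y))"

definition nonneg_selfadjoint :: "('a::real_inner \<Rightarrow> 'a) \<Rightarrow> bool" where
  "nonneg_selfadjoint T \<longleftrightarrow> selfadjoint T \<and> (\<forall>x. 0 \<le> inner (T x) x)"

lemma selfadjoint_linear: "selfadjoint T \<Longrightarrow> linear T"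
  by (simp add: selfadjoint_def bounded_linear.linear)

text \<open>Evaluate the non-negative form at \<open>x - T x / c\<close>.\<close>

lemma norm_power2_le_quadratic_form:
  fixes T :: "'a::real_inner \<Rightarrow> 'a"
  assumes lin: "linear T" and S: "subspace S" and TS: "\<And>x. x \<in> S \<Longrightarrow> T x \<in> S"
    and sym: "\<And>x y. x \<in> S \<Longrightarrow> y \<in> S \<Longrightarrow> inner (T x) y = inner x (T y)"
    and pos: "\<And>x. x \<in> S \<Longrightarrow> 0 \<le> inner (T x) x"
    and le: "\<And>x. x \<in> S \<Longrightarrow> inner (T x) x \<le> c * (norm x)\<^sup>2"
    and c: "0 < c" and x: "x \<in> S"
  shows "(norm (T x))\<^sup>2 \<le> c * inner (T x) x"
proof -
  let ?y = "T x"
  have y: "?y \<in> S" using TS x .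
  have z: "x - (1/c) *\<^sub>R ?y \<in> S"
    using S x y by (simp add: subspace_diff subspace_scale)
  have "0 \<le> inner (T (x - (1/c) *\<^sub>R ?y)) (x - (1/c) *\<^sub>R ?y)"
    using pos[OF z] .
  also have "\<dots> = inner (T x) x - 2 / c * (norm ?y)\<^sup>2 + (1/c)\<^sup>2 * inner (T ?y) ?y"
    using lin sym[OF y x]
    by (simp add: linear_diff linear_scale inner_diff_left inner_diff_right dot_square_norm
        algebra_simps power2_eq_square inner_commute)
  also have "\<dots> \<le> inner (T x) x - 2 / c * (norm ?y)\<^sup>2 + (1/c)\<^sup>2 * (c * (norm ?y)\<^sup>2)"
    by (intro add_left_mono mult_left_mono le y) simp
  also have "\<dots> = inner (T x) x - (norm ?y)\<^sup>2 / c"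
    using c by (simp add: field_simps power2_eq_square)
  finally show ?thesis using c by (simp add: field_simps)
qed

text \<open>The form bound is inserted once more into the previous inequality. Working on an
  invariant subspace \<open>S\<close> allows an upper bound of the form that holds only there, as on
  a spectral subspace.\<close>

lemma norm_le_of_quadratic_form_le:
  fixes T :: "'a::real_inner \<Rightarrow> 'a"
  assumes "linear T" and "subspace S" and "\<And>x. x \<in> S \<Longrightarrow> T x \<in> S"
    and "\<And>x y. x \<in> S \<Longrightarrow> y \<in> S \<Longrightarrow> inner (T x) y = inner x (T y)"
    and "\<And>x. x \<in> S \<Longrightarrow> 0 \<le> inner (T x) x"
    and le: "\<And>x. x \<in> S \<Longrightarrow> inner (T x) x \<le> c * (norm x)\<^sup>2"
    and c: "0 < c" and x: "x \<in> S"
  shows "norm (T x) \<le> c * norm x"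
proof -
  have "(norm (T x))\<^sup>2 \<le> c * inner (T x) x"
    by (rule norm_power2_le_quadratic_form[where S = S]) (use assms in blast)+
  also have "\<dots> \<le> c * (c * (norm x)\<^sup>2)"
    using c by (intro mult_left_mono le x) simp
  finally have "(norm (T x))\<^sup>2 \<le> (c * norm x)\<^sup>2"
    by (simp add: power2_eq_square mult_ac)
  then show ?thesis
    by (rule power2_le_imp_le) (use c in simp)
qed

section \<open>Operator-norm convergence of the square root iteration\<close>

fun sqrt_iteration ::
    "('a::real_normed_vector \<Rightarrow>\<^sub>L 'a) \<Rightarrow> nat \<Rightarrow> 'a \<Rightarrow>\<^sub>L 'a" where
  "sqrt_iteration A 0 = 0"
| "sqrt_iteration A (Suc n) = (1/2) *\<^sub>R (A + (sqrt_iteration A n o\<^sub>L sqrt_iteration A n))"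

text \<open>A majorant replaces the contraction principle: on the unit ball the map
  \<open>Y \<mapsto> (A + Y Y) / 2\<close> has Lipschitz constant 1 only, so no geometric rate is at
  hand.\<close>

fun scalar_sqrt_iteration :: "nat \<Rightarrow> real" where
  "scalar_sqrt_iteration 0 = 0"
| "scalar_sqrt_iteration (Suc n) = (1 + (scalar_sqrt_iteration n)\<^sup>2) / 2"

lemma scalar_sqrt_iteration_bounds: "0 \<le> scalar_sqrt_iteration n \<and> scalar_sqrt_iteration n \<le> 1"
proof (induction n)
  case (Suc n)
  then have "(scalar_sqrt_iteration n)\<^sup>2 \<le> 1" by (simp add: power_le_one)
  then show ?case by simp
qed simp

lemma scalar_sqrt_iteration_mono: "scalar_sqrt_iteration n \<le> scalar_sqrt_iteration (Suc n)"
proof -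
  have "0 \<le> (1 - scalar_sqrt_iteration n)\<^sup>2" by simp
  then show ?thesis by (simp add: power2_eq_square algebra_simps)
qed

lemma norm_sqrt_iteration:
  assumes "norm A \<le> 1"
  shows "norm (sqrt_iteration A n) \<le> scalar_sqrt_iteration n"
proof (induction n)
  case (Suc n)
  let ?Y = "sqrt_iteration A n"
  have "norm (?Y o\<^sub>L ?Y) \<le> norm ?Y * norm ?Y"
    by (rule norm_blinfun_compose)
  also have "\<dots> \<le> (scalar_sqrt_iteration n)\<^sup>2"
    unfolding power2_eq_square by (intro mult_mono Suc) (use scalar_sqrt_iteration_bounds in auto)
  finally have "norm (A + (?Y o\<^sub>L ?Y)) \<le> 1 + (scalar_sqrt_iteration n)\<^sup>2"
    using assms by (meson add_mono norm_triangle_le)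
  then show ?case by simp
qed simp

text \<open>The splitting Z Z - Y Y = Z (Z - Y) + (Z - Y) Y is valid for non-commuting operators,
  and its scalar counterpart is an identity of the majorant, so the bound reproduces itself from
  \<open>n\<close> to \<open>Suc n\<close>.\<close>

lemma norm_sqrt_iteration_diff:
  assumes A: "norm A \<le> 1"
  shows "norm (sqrt_iteration A (Suc n) - sqrt_iteration A n)
    \<le> scalar_sqrt_iteration (Suc n) - scalar_sqrt_iteration n"
proof (induction n)
  case 0
  then show ?case using A by simp
next
  case (Suc n)
  let ?Y = "sqrt_iteration A n" and ?Z = "sqrt_iteration A (Suc n)"
  let ?y = "scalar_sqrt_iteration n" and ?z = "scalar_sqrt_iteration (Suc n)"
  interpret C: bounded_bilinear "(o\<^sub>L) :: ('a \<Rightarrow>\<^sub>L 'a) \<Rightarrow> ('a \<Rightarrow>\<^sub>L 'a) \<Rightarrow> 'a \<Rightarrow>\<^sub>L 'a"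
    by (rule bounded_bilinear_blinfun_compose)
  have diff: "sqrt_iteration A (Suc (Suc n)) - ?Z =
      (1/2) *\<^sub>R ((?Z o\<^sub>L (?Z - ?Y)) + ((?Z - ?Y) o\<^sub>L ?Y))"
    by (simp add: C.diff_left C.diff_right algebra_simps del: sqrt_iteration.simps(2))
       (simp add: algebra_simps)
  have "norm ((?Z o\<^sub>L (?Z - ?Y)) + ((?Z - ?Y) o\<^sub>L ?Y))
      \<le> norm ?Z * norm (?Z - ?Y) + norm (?Z - ?Y) * norm ?Y"
    by (intro norm_triangle_mono norm_blinfun_compose)
  also have "\<dots> \<le> ?z * (?z - ?y) + (?z - ?y) * ?y"
    by (intro add_mono mult_mono Suc norm_sqrt_iteration A norm_ge_zero)
       (use scalar_sqrt_iteration_bounds scalar_sqrt_iteration_mono[of n] in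
         \<open>auto simp del: scalar_sqrt_iteration.simps(2)\<close>)
  also have "\<dots> = 2 * (scalar_sqrt_iteration (Suc (Suc n)) - ?z)"
    by (simp add: field_simps power2_eq_square)
  finally show ?case
    unfolding diff by (simp del: sqrt_iteration.simps(2) scalar_sqrt_iteration.simps(2))
qed

lemma norm_sqrt_iteration_diff_le:
  assumes A: "norm A \<le> 1" and "m \<le> n"
  shows "norm (sqrt_iteration A n - sqrt_iteration A m)
    \<le> scalar_sqrt_iteration n - scalar_sqrt_iteration m"
  using \<open>m \<le> n\<close>
proof (induction n rule: dec_induct)
  case (step n)
  have "sqrt_iteration A (Suc n) - sqrt_iteration A m =
      (sqrt_iteration A (Suc n) - sqrt_iteration A n) + (sqrt_iteration A n - sqrt_iteration A m)"
    by (simp del: sqrt_iteration.simps(2))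
  then show ?case
    using norm_triangle_le[of "sqrt_iteration A (Suc n) - sqrt_iteration A n"
        "sqrt_iteration A n - sqrt_iteration A m"] norm_sqrt_iteration_diff[OF A, of n] step.IH
    by (smt (verit))
qed simp

lemma convergent_sqrt_iteration:
  fixes A :: "'a::banach \<Rightarrow>\<^sub>L 'a"
  assumes A: "norm A \<le> 1"
  shows "convergent (sqrt_iteration A)"
proof -
  have "convergent scalar_sqrt_iteration"
  proof (rule Bseq_monoseq_convergent)
    show "Bseq scalar_sqrt_iteration"
      by (rule BseqI'[where K = 1]) (use scalar_sqrt_iteration_bounds in auto)
    show "monoseq scalar_sqrt_iteration"
      unfolding monoseq_Suc using scalar_sqrt_iteration_mono by blast
  qed
  then have C: "Cauchy scalar_sqrt_iteration" by (rule convergent_Cauchy)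
  have "Cauchy (sqrt_iteration A)"
    \<comment> \<open>This form of the Cauchy condition compares later terms with the single index
      \<open>N\<close>, exactly the ordered pairs covered by
      \<open>norm_sqrt_iteration_diff_le\<close>.\<close>
    unfolding Cauchy_altdef2
  proof (intro allI impI)
    fix e :: real assume "e > 0"
    then obtain N where "\<forall>n\<ge>N. dist (scalar_sqrt_iteration n) (scalar_sqrt_iteration N) < e"
      using C unfolding Cauchy_altdef2 by blast
    then show "\<exists>N. \<forall>n\<ge>N. dist (sqrt_iteration A n) (sqrt_iteration A N) < e"
      using norm_sqrt_iteration_diff_le[OF A] unfolding dist_norm real_norm_def
      by (meson abs_ge_self le_less_trans)
  qed
  then show ?thesis by (simp add: Cauchy_convergent_iff)
qed

text \<open>
  Scaling \<open>T\<close> so that \<open>T = 1 - A\<close> with \<open>\<parallel>A\<parallel> \<le> 1\<close>, the iteration \<open>Y \<leftarrow> (A + Y\<^sup>2) / 2\<close> is dominated by the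
  same iteration on scalars with \<open>A\<close> replaced by \<open>1\<close>; hence it converges in the operator norm, and
  its limit satisfies \<open>(1 - Y)\<^sup>2 = 1 - A\<close>.
\<close>

theorem nonneg_selfadjoint_sqrt:
  fixes T :: "'a::{real_inner,banach} \<Rightarrow> 'a"
  assumes T: "nonneg_selfadjoint T"
  obtains R where "nonneg_selfadjoint R" and "\<And>x. R (R x) = T x"
    and "\<And>S x. bounded_linear S \<Longrightarrow> (\<And>x. S (T x) = T (S x)) \<Longrightarrow> S (R x) = R (S x)"
proof -
  have blT: "bounded_linear T" and symT: "\<And>x y. inner (T x) y = inner x (T y)"
    and posT: "\<And>x. 0 \<le> inner (T x) x"
    using T by (auto simp: nonneg_selfadjoint_def selfadjoint_def)
  interpret T: bounded_linear T by (rule blT)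
  obtain c where c: "c > 0" and cT: "\<And>x. norm (T x) \<le> norm x * c"
    using T.pos_bounded by blast
  define A where "A = id_blinfun - (1/c) *\<^sub>R Blinfun T"
  have A: "blinfun_apply A x = x - (1/c) *\<^sub>R T x" for x
    by (simp add: A_def blinfun.diff_left blinfun.scaleR_left bounded_linear_Blinfun_apply blT)
  \<comment> \<open>As \<open>c\<close> bounds the norm of \<open>T\<close>, the form of
    \<open>A\<close> lies between 0 and \<open>(norm x)^2\<close>. The form bound then yields 1,
    where the triangle inequality would yield only 2.\<close>
  have nA: "norm A \<le> 1"
  proof (rule norm_blinfun_bound)
    fix x
    have "norm (blinfun_apply A x) \<le> 1 * norm x"
    proof (rule norm_le_of_quadratic_form_le[where S = UNIV])
      show "linear (blinfun_apply A)"
        by (simp add: blinfun.bounded_linear_right bounded_linear.linear)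
      fix x
      have "inner (T x) x \<le> c * (norm x)\<^sup>2"
        using norm_cauchy_schwarz[of "T x" x] mult_right_mono[OF cT[of x], of "norm x"]
        by (simp add: power2_eq_square algebra_simps)
      then show "0 \<le> inner (blinfun_apply A x) x"
        using c by (simp add: A inner_diff_left dot_square_norm field_simps)
      show "inner (blinfun_apply A x) x \<le> 1 * (norm x)\<^sup>2"
        using c posT[of x] by (simp add: A inner_diff_left dot_square_norm)
    qed (auto simp: A inner_diff_left inner_diff_right symT)
    then show "norm (blinfun_apply A x) \<le> 1 * norm x" .
  qed simp
  obtain Y where Y: "sqrt_iteration A \<longlonglongrightarrow> Y"
    using convergent_sqrt_iteration[OF nA] by (auto simp: convergent_def)
  have Yx: "(\<lambda>n. blinfun_apply (sqrt_iteration A n) x) \<longlonglongrightarrow> blinfun_apply Y x" for x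
    by (intro blinfun.tendsto Y tendsto_const)
  have "(\<lambda>n. sqrt_iteration A (Suc n)) \<longlonglongrightarrow> (1/2) *\<^sub>R (A + (Y o\<^sub>L Y))"
    unfolding sqrt_iteration.simps
    by (intro tendsto_intros Y bounded_bilinear.tendsto[OF bounded_bilinear_blinfun_compose])
  then have YY: "Y = (1/2) *\<^sub>R (A + (Y o\<^sub>L Y))"
    using LIMSEQ_Suc[OF Y] LIMSEQ_unique by blast
  have YYx: "2 *\<^sub>R blinfun_apply Y x = blinfun_apply A x + blinfun_apply Y (blinfun_apply Y x)" for x
  proof -
    have "blinfun_apply Y x = blinfun_apply ((1/2) *\<^sub>R (A + (Y o\<^sub>L Y))) x"
      using YY by simp
    then have "blinfun_apply Y x
        = (1/2) *\<^sub>R (blinfun_apply A x + blinfun_apply Y (blinfun_apply Y x))"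
      by (simp add: blinfun.scaleR_left blinfun.add_left)
    from arg_cong[OF this, of "\<lambda>z. 2 *\<^sub>R z"] show ?thesis
      by (simp only: scaleR_scaleR) simp
  qed
  have nY: "norm Y \<le> 1"
  proof (rule LIMSEQ_le_const2[OF tendsto_norm[OF Y]])
    show "\<exists>N. \<forall>n\<ge>N. norm (sqrt_iteration A n) \<le> 1"
      using norm_sqrt_iteration[OF nA] scalar_sqrt_iteration_bounds by (meson order_trans)
  qed
  have sym_iter: "inner (blinfun_apply (sqrt_iteration A n) x) y
      = inner x (blinfun_apply (sqrt_iteration A n) y)" for n x y
    by (induction n arbitrary: x y)
       (auto simp: blinfun.scaleR_left blinfun.add_left A inner_diff_left inner_diff_right
          inner_add_left inner_add_right symT)
  have symY: "inner (blinfun_apply Y x) y = inner x (blinfun_apply Y y)" for x y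
  proof (rule LIMSEQ_unique)
    show "(\<lambda>n. inner (blinfun_apply (sqrt_iteration A n) x) y) \<longlonglongrightarrow> inner (blinfun_apply Y x) y"
      by (intro tendsto_intros Yx)
    show "(\<lambda>n. inner (blinfun_apply (sqrt_iteration A n) x) y) \<longlonglongrightarrow> inner x (blinfun_apply Y y)"
      unfolding sym_iter by (intro tendsto_intros Yx)
  qed
  define R where "R x = sqrt c *\<^sub>R (x - blinfun_apply Y x)" for x
  have blR: "bounded_linear R"
    unfolding R_def by (intro bounded_linear_intros blinfun.bounded_linear_right)
  have "nonneg_selfadjoint R"
    unfolding nonneg_selfadjoint_def selfadjoint_def
  proof (intro conjI allI blR)
    fix x y
    show "inner (R x) y = inner x (R y)"
      by (simp add: R_def inner_diff_left inner_diff_right symY)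
    have "inner (blinfun_apply Y x) x \<le> norm (blinfun_apply Y x) * norm x"
      by (rule norm_cauchy_schwarz)
    also have "\<dots> \<le> norm x * norm x"
      using norm_blinfun[of Y x] nY
      by (meson mult_left_le_one_le mult_right_mono norm_ge_zero order_trans)
    finally show "0 \<le> inner (R x) x"
      using c by (simp add: R_def inner_diff_left dot_square_norm power2_eq_square)
  qed
  moreover have "R (R x) = T x" for x
  proof -
    have "R (R x) = c *\<^sub>R (x - 2 *\<^sub>R blinfun_apply Y x + blinfun_apply Y (blinfun_apply Y x))"
      using c by (simp add: R_def blinfun.diff_right blinfun.scaleR_right scaleR_2 algebra_simps)
    also have "\<dots> = T x"
      unfolding YYx A using c by simp
    finally show ?thesis .
  qed
  \<comment> \<open>Each iterate is a polynomial in \<open>A\<close>, hence commutes with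
    \<open>S\<close>, and this survives the limit. The intended \<open>S\<close> are multiplication
    by complex scalars and restriction to \<open>V\<close>.\<close>
  moreover have "S (R x) = R (S x)"
    if S: "bounded_linear S" and ST: "\<And>x. S (T x) = T (S x)" for S x
  proof -
    interpret S: bounded_linear S by (rule S)
    have iter: "S (blinfun_apply (sqrt_iteration A n) x) = blinfun_apply (sqrt_iteration A n) (S x)"
      for n x
      by (induction n arbitrary: x)
         (auto simp: blinfun.scaleR_left blinfun.add_left A S.scaleR S.add S.diff ST S.zero)
    have "S (blinfun_apply Y x) = blinfun_apply Y (S x)"
    proof (rule LIMSEQ_unique)
      show "(\<lambda>n. S (blinfun_apply (sqrt_iteration A n) x)) \<longlonglongrightarrow> S (blinfun_apply Y x)"
        by (intro S.tendsto Yx)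
      show "(\<lambda>n. S (blinfun_apply (sqrt_iteration A n) x)) \<longlonglongrightarrow> blinfun_apply Y (S x)"
        unfolding iter by (intro Yx)
    qed
    then show ?thesis by (simp add: R_def S.scaleR S.diff)
  qed
  ultimately show thesis using that by blast
qed

section \<open>Minimal norm on affine subspaces\<close>

lemma selfadjoint_funpow:
  "selfadjoint T \<Longrightarrow> inner ((T ^^ k) x) y = inner x ((T ^^ k) y)"
  by (induction k arbitrary: x y) (auto simp: selfadjoint_def funpow_swap1)

lemma bounded_linear_funpow:
  "bounded_linear T \<Longrightarrow> bounded_linear (T ^^ k)" for T :: "'a::real_normed_vector \<Rightarrow> 'a"
  by (induction k) (auto simp: id_def bounded_linear_ident intro: bounded_linear_compose[unfolded o_def[symmetric]])

text \<open>From \<open>\<parallel>x\<parallel>\<^sup>2 \<le> a\<^sup>2 \<parallel>R x\<parallel>\<^sup>2 = a\<^sup>2 \<langle>R\<^sup>2 x, x\<rangle>\<close> the bound passes to \<open>R\<^sup>2\<close> at the same vector \<open>x\<close>.\<close>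

lemma norm_le_power_two_iterate:
  assumes R: "selfadjoint R" and a: "0 \<le> a" and x: "norm x \<le> a * norm (R x)"
  shows "norm x \<le> a ^ (2 ^ l) * norm ((R ^^ (2 ^ l)) x)"
proof (induction l)
  case (Suc l)
  let ?k = "2 ^ l :: nat"
  have "(norm x)\<^sup>2 \<le> (a ^ ?k * norm ((R ^^ ?k) x))\<^sup>2"
    by (rule power_mono[OF Suc]) simp
  also have "\<dots> = a ^ (2 * ?k) * inner ((R ^^ ?k) ((R ^^ ?k) x)) x"
    using selfadjoint_funpow[OF R, of ?k "(R ^^ ?k) x" x]
    by (simp add: power_mult_distrib power_mult[symmetric] dot_square_norm mult.commute)
  also have "\<dots> = a ^ (2 * ?k) * inner ((R ^^ (2 * ?k)) x) x"
    by (simp only: mult_2 funpow_add o_apply)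
  also have "\<dots> \<le> a ^ (2 * ?k) * (norm ((R ^^ (2 * ?k)) x) * norm x)"
    by (intro mult_left_mono norm_cauchy_schwarz) (use a in auto)
  finally have "norm x * norm x \<le> (a ^ (2 * ?k) * norm ((R ^^ (2 * ?k)) x)) * norm x"
    by (simp add: power2_eq_square mult_ac)
  then show ?case
    using a by (cases "x = 0") auto
qed (use x in simp)

lemma parallelogram_midpoint:
  fixes x y :: "'a::real_inner"
  shows "(norm (x - y))\<^sup>2 = 2 * (norm x)\<^sup>2 + 2 * (norm y)\<^sup>2 - 4 * (norm ((1/2) *\<^sub>R (x + y)))\<^sup>2"
proof -
  have 1: "4 * (norm ((1/2) *\<^sub>R (x + y)))\<^sup>2 = inner (x + y) (x + y)"
    by (simp add: power_divide power2_norm_eq_inner)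
  show ?thesis
    unfolding 1 by (simp add: power2_norm_eq_inner inner_diff_left inner_diff_right
        inner_add_left inner_add_right inner_commute[of y x])
qed

text \<open>The projection theorem for the seminorm \<open>norm (A u)\<close>. The parallelogram law
  makes the images of a minimizing sequence Cauchy; differences of competitors lie in
  \<open>N\<close>, so coercivity lifts this to the sequence itself, and completeness of the domain
  gives the limit.\<close>

lemma ex1_minimal_norm_on_affine:
  fixes A :: "'a::banach \<Rightarrow> 'b::real_inner"
  assumes A: "bounded_linear A" and N: "subspace N" "closed N"
    and coercive: "\<And>x. x \<in> N \<Longrightarrow> norm x \<le> c * norm (A x)"
  shows "\<exists>!s. s - f \<in> N \<and> (\<forall>u. u - f \<in> N \<longrightarrow> norm (A s) \<le> norm (A u))"
proof -
  interpret A: bounded_linear A by (rule A)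
  let ?F = "{u. u - f \<in> N}"
  define d where "d = (INF u\<in>?F. norm (A u))"
  have fF: "f \<in> ?F" using N by (simp add: subspace_0)
  have ne: "?F \<noteq> {}" using fF by (metis empty_iff)
  have bdd: "bdd_below ((\<lambda>u. norm (A u)) ` ?F)" by (rule bdd_belowI2[of _ 0]) simp
  have dle: "d \<le> norm (A u)" if "u \<in> ?F" for u
    unfolding d_def using bdd that by (rule cINF_lower)
  have d0: "0 \<le> d" unfolding d_def by (rule cINF_greatest[OF ne]) simp
  have mid: "(norm (A (u - v)))\<^sup>2 \<le> 2 * (norm (A u))\<^sup>2 + 2 * (norm (A v))\<^sup>2 - 4 * d\<^sup>2"
    if u: "u \<in> ?F" and v: "v \<in> ?F" for u v
  proof -
    have eq: "(1/2) *\<^sub>R (u + v) - f = (1/2) *\<^sub>R ((u - f) + (v - f))"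
      by (simp add: algebra_simps flip: scaleR_add_left)
    have "(1/2) *\<^sub>R (u + v) \<in> ?F"
      unfolding mem_Collect_eq eq using N u v by (intro subspace_scale subspace_add) auto
    then have "d\<^sup>2 \<le> (norm (A ((1/2) *\<^sub>R (u + v))))\<^sup>2"
      using dle d0 by (intro power_mono) auto
    then show ?thesis
      unfolding A.diff parallelogram_midpoint[of "A u" "A v"] by (simp add: A.scaleR A.add)
  qed
  have diffN: "u - v \<in> N" if "u \<in> ?F" "v \<in> ?F" for u v
    using subspace_diff[OF N(1), of "u - f" "v - f"] that by simp
  have c_abs: "norm x \<le> \<bar>c\<bar> * norm (A x)" if "x \<in> N" for x
    using coercive[OF that] by (meson abs_ge_self mult_right_mono norm_ge_zero order_trans)
  have "\<exists>u. u \<in> ?F \<and> norm (A u) < d + 1 / real (Suc n)" for n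
  proof -
    have "d < d + 1 / real (Suc n)" by simp
    then show ?thesis
      using cINF_less_iff[OF _ bdd, of "d + 1 / real (Suc n)"] fF unfolding d_def by blast
  qed
  then obtain X where XF: "X n \<in> ?F" and Xd: "norm (A (X n)) < d + 1 / real (Suc n)" for n
    by metis
  have AX: "(\<lambda>n. norm (A (X n))) \<longlonglongrightarrow> d"
  proof (rule tendsto_sandwich)
    show "\<forall>\<^sub>F n in sequentially. d \<le> norm (A (X n))" using dle XF by simp
    show "\<forall>\<^sub>F n in sequentially. norm (A (X n)) \<le> d + 1 / real (Suc n)"
      using Xd by (simp add: less_imp_le)
    show "(\<lambda>n. d + 1 / real (Suc n)) \<longlonglongrightarrow> d"
      using tendsto_add[OF tendsto_const LIMSEQ_Suc[OF lim_1_over_n], of d] by simp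
  qed simp
  have "Cauchy X"
  proof (rule metric_CauchyI)
    fix e :: real assume e: "e > 0"
    \<comment> \<open>Two terms within \<open>e' / 4\<close> of \<open>d^2\<close> give
      \<open>e'\<close> in \<open>mid\<close>, since the multiples of \<open>d^2\<close> cancel; its
      root times \<open>\<bar>c\<bar> + 1\<close> is \<open>e\<close>. The added 1 keeps the
      denominator positive.\<close>
    define e' where "e' = (e / (\<bar>c\<bar> + 1))\<^sup>2"
    have e': "e' > 0" using e by (simp add: e'_def)
    have "(\<lambda>n. (norm (A (X n)))\<^sup>2) \<longlonglongrightarrow> d\<^sup>2" by (intro tendsto_intros AX)
    then have "\<forall>\<^sub>F n in sequentially. (norm (A (X n)))\<^sup>2 < d\<^sup>2 + e' / 4"
      by (rule order_tendstoD) (use e' in simp)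
    then obtain M where M: "\<And>n. n \<ge> M \<Longrightarrow> (norm (A (X n)))\<^sup>2 < d\<^sup>2 + e' / 4"
      by (auto simp: eventually_sequentially)
    show "\<exists>M. \<forall>m\<ge>M. \<forall>n\<ge>M. dist (X m) (X n) < e"
    proof (intro exI allI impI)
      fix m n assume mn: "M \<le> m" "M \<le> n"
      have "(norm (A (X m - X n)))\<^sup>2 < e'"
        using mid[OF XF XF, of m n] M[OF mn(1)] M[OF mn(2)] by simp
      then have "norm (A (X m - X n)) < e / (\<bar>c\<bar> + 1)"
        unfolding e'_def by (rule power_less_imp_less_base) (use e in simp)
      then have "(\<bar>c\<bar> + 1) * norm (A (X m - X n)) < e"
        by (simp add: field_simps)
      moreover have "norm (X m - X n) \<le> (\<bar>c\<bar> + 1) * norm (A (X m - X n))"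
        using c_abs[OF diffN[OF XF XF], of m n] by (rule order_trans) (simp add: mult_right_mono)
      ultimately show "dist (X m) (X n) < e" unfolding dist_norm by (rule le_less_trans[rotated])
    qed
  qed
  then obtain s where s: "X \<longlonglongrightarrow> s" by (auto simp: Cauchy_convergent_iff convergent_def)
  have sN: "s - f \<in> N"
    by (rule closed_sequentially[OF N(2), of "\<lambda>n. X n - f"])
       (use XF in \<open>auto intro!: tendsto_intros s\<close>)
  have sd: "norm (A s) = d"
    by (rule LIMSEQ_unique[OF tendsto_norm[OF A.tendsto[OF s]] AX])
  show ?thesis
  proof (rule ex1I[of _ s])
    show "s - f \<in> N \<and> (\<forall>u. u - f \<in> N \<longrightarrow> norm (A s) \<le> norm (A u))"
      unfolding sd using sN dle by blast
    fix s' assume s': "s' - f \<in> N \<and> (\<forall>u. u - f \<in> N \<longrightarrow> norm (A s') \<le> norm (A u))"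
    have sF: "s \<in> ?F" "s' \<in> ?F" using sN s' by blast+
    have "norm (A s') \<le> d" using s' sN sd by metis
    then have "(norm (A s'))\<^sup>2 \<le> d\<^sup>2" by (intro power_mono) auto
    then have "(norm (A (s' - s)))\<^sup>2 \<le> 0"
      using mid[OF sF(2) sF(1)] unfolding sd by linarith
    then have "norm (A (s' - s)) = 0" by simp
    then have "norm (s' - s) \<le> 0"
      using c_abs[OF diffN[OF sF(2) sF(1)]] by (metis mult_zero_right)
    then show "s' = s" by simp
  qed
qed

text \<open>The first variation without a derivative: the best step \<open>t\<close> along
  \<open>h\<close> would lower the square of the norm by
  \<open>(inner (A s) (A h))^2 / inner (A h) (A h)\<close>, so minimality forces this to
  vanish.\<close>

lemma minimal_norm_on_affine_orthogonal:
  fixes A :: "'a::real_vector \<Rightarrow> 'b::real_inner"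
  assumes A: "linear A" and N: "subspace N" and s: "s - f \<in> N"
    and min: "\<And>u. u - f \<in> N \<Longrightarrow> norm (A s) \<le> norm (A u)" and h: "h \<in> N"
  shows "inner (A s) (A h) = 0"
proof (cases "A h = 0")
  case False
  define t where "t = - inner (A s) (A h) / inner (A h) (A h)"
  have pos: "inner (A h) (A h) > 0" using False by simp
  have eq: "s + t *\<^sub>R h - f = (s - f) + t *\<^sub>R h" by simp
  have "s + t *\<^sub>R h - f \<in> N"
    unfolding eq using N s h by (intro subspace_add subspace_scale)
  then have "(norm (A s))\<^sup>2 \<le> (norm (A (s + t *\<^sub>R h)))\<^sup>2"
    using min by (intro power_mono) auto
  also have "\<dots> = (norm (A s))\<^sup>2 + 2 * t * inner (A s) (A h) + t * t * inner (A h) (A h)"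
    using A by (simp add: linear_add linear_scale power2_norm_eq_inner inner_add_left
        inner_add_right inner_commute algebra_simps)
  also have "\<dots> = (norm (A s))\<^sup>2 - (inner (A s) (A h))\<^sup>2 / inner (A h) (A h)"
    using pos by (simp add: t_def field_simps power2_eq_square)
  finally have "(inner (A s) (A h))\<^sup>2 / inner (A h) (A h) \<le> 0" by simp
  then have "(inner (A s) (A h))\<^sup>2 \<le> 0" using pos by (simp add: divide_le_0_iff)
  then show ?thesis by simp
qed simp

text \<open>
  Orthogonality of the minimizer gives \<open>\<parallel>R\<^sup>k g\<parallel>\<^sup>2 = \<langle>R\<^sup>k f, R\<^sup>k g\<rangle> = \<langle>R\<^bsup>2k\<^esup> f, g\<rangle>\<close> for the error \<open>g = f - s\<close>;
  this duality doubles the exponent that minimality alone would give.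
\<close>

lemma minimal_norm_error:
  fixes R :: "'a::real_inner \<Rightarrow> 'a"
  assumes R: "selfadjoint R" and N: "subspace N" and s: "s - f \<in> N"
    and min: "\<And>u. u - f \<in> N \<Longrightarrow> norm ((R ^^ k) s) \<le> norm ((R ^^ k) u)"
    and a: "0 \<le> a"
    and coercive: "\<And>x. x \<in> N \<Longrightarrow> norm x \<le> a * norm ((R ^^ k) x)"
    and f: "norm ((R ^^ (2 * k)) f) \<le> b * norm f"
  shows "norm (f - s) \<le> a\<^sup>2 * b * norm f"
proof -
  let ?A = "R ^^ k" and ?g = "f - s"
  have lin: "linear ?A"
    using R bounded_linear_funpow by (auto simp: selfadjoint_def intro: bounded_linear.linear)
  have g: "?g \<in> N" using subspace_neg[OF N s] by simp
  have "(norm ?g)\<^sup>2 \<le> (a * norm (?A ?g))\<^sup>2"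
    by (intro power_mono coercive g) simp
  also have "(norm (?A ?g))\<^sup>2 = inner (?A f) (?A ?g)"
  proof -
    have "inner (?A s) (?A ?g) = 0"
      by (rule minimal_norm_on_affine_orthogonal[OF lin N s min g])
    then show ?thesis
      by (simp add: linear_diff[OF lin] power2_norm_eq_inner inner_diff_left)
  qed
  then have "(a * norm (?A ?g))\<^sup>2 = a\<^sup>2 * inner ((R ^^ (2 * k)) f) ?g"
    using selfadjoint_funpow[OF R, of k "?A f" ?g]
    by (simp add: power_mult_distrib mult_2 funpow_add)
  also have "\<dots> \<le> a\<^sup>2 * (norm ((R ^^ (2 * k)) f) * norm ?g)"
    by (intro mult_left_mono norm_cauchy_schwarz) simp
  also have "\<dots> \<le> a\<^sup>2 * ((b * norm f) * norm ?g)"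
    by (intro mult_left_mono mult_right_mono f) auto
  finally have le: "norm ?g * norm ?g \<le> (a\<^sup>2 * b * norm f) * norm ?g"
    by (simp add: power2_eq_square mult_ac)
  show ?thesis
  proof (cases "?g = 0")
    case True
    \<comment> \<open>\<open>b\<close> carries no sign of its own; the bound on the iterate of
      \<open>f\<close> makes the product non-negative.\<close>
    have "0 \<le> b * norm f" using f norm_ge_zero order_trans by blast
    then show ?thesis using True by (simp add: mult.assoc del: right_minus_eq)
  qed (use le in auto)
qed

section \<open>The Hilbert space of square-summable functions\<close>

definition square_summable :: "('v \<Rightarrow> complex) \<Rightarrow> bool" where
  "square_summable f \<longleftrightarrow> (\<lambda>v. (cmod (f v))\<^sup>2) summable_on UNIV"

lemma norm_add_power2_le: "(norm (x + y))\<^sup>2 \<le> 2 * (norm x)\<^sup>2 + 2 * (norm y)\<^sup>2"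
  for x y :: "'a::real_normed_vector"
proof -
  have "(norm (x + y))\<^sup>2 \<le> (norm x + norm y)\<^sup>2"
    by (intro power_mono norm_triangle_ineq) simp
  also have "\<dots> \<le> 2 * (norm x)\<^sup>2 + 2 * (norm y)\<^sup>2"
    using zero_le_power2[of "norm x - norm y"] by (simp add: power2_eq_square algebra_simps)
  finally show ?thesis .
qed

lemma norm_diff_power2_le: "(norm (x - y))\<^sup>2 \<le> 2 * (norm x)\<^sup>2 + 2 * (norm y)\<^sup>2"
  for x y :: "'a::real_normed_vector"
  using norm_add_power2_le[of x "- y"] by simp

lemma square_summable_zero: "square_summable (\<lambda>_. 0)"
  by (simp add: square_summable_def)

lemma square_summable_add:
  assumes "square_summable f" "square_summable g"
  shows "square_summable (\<lambda>v. f v + g v)"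
  unfolding square_summable_def
proof (rule summable_on_comparison_test)
  show "(\<lambda>v. 2 * (cmod (f v))\<^sup>2 + 2 * (cmod (g v))\<^sup>2) summable_on UNIV"
    using assms unfolding square_summable_def
    by (intro summable_on_add summable_on_cmult_right)
qed (auto intro: norm_add_power2_le)

lemma square_summable_mult:
  "square_summable f \<Longrightarrow> square_summable (\<lambda>v. c * f v)"
  unfolding square_summable_def
  by (simp add: norm_mult power_mult_distrib summable_on_cmult_right)

lemma square_summable_scaleR:
  "square_summable f \<Longrightarrow> square_summable (\<lambda>v. c *\<^sub>R f v)"
  unfolding scaleR_conv_of_real by (rule square_summable_mult)

lemma square_summable_uminus: "square_summable f \<Longrightarrow> square_summable (\<lambda>v. - f v)"
  by (simp add: square_summable_def)

lemma square_summable_diff: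
  "square_summable f \<Longrightarrow> square_summable g \<Longrightarrow> square_summable (\<lambda>v. f v - g v)"
  using square_summable_add[of f "\<lambda>v. - g v"] square_summable_uminus[of g] by simp

lemma abs_summable_mult_cnj:
  assumes "(\<lambda>v. (cmod (f v))\<^sup>2) summable_on A" "(\<lambda>v. (cmod (g v))\<^sup>2) summable_on A"
  shows "(\<lambda>v. norm (f v * cnj (g v))) summable_on A"
proof (rule summable_on_comparison_test)
  show "(\<lambda>v. (1/2) * ((cmod (f v))\<^sup>2 + (cmod (g v))\<^sup>2)) summable_on A"
    by (intro summable_on_cmult_right summable_on_add assms)
  show "norm (f v * cnj (g v)) \<le> (1/2) * ((cmod (f v))\<^sup>2 + (cmod (g v))\<^sup>2)" for v
    using zero_le_power2[of "cmod (f v) - cmod (g v)"]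
    by (simp add: norm_mult power2_eq_square algebra_simps)
qed simp

text \<open>
  The complex space \<open>L\<^sub>2\<close> is treated as a real Hilbert space with inner product \<open>Re \<langle>f, g\<rangle>\<close>;
  complex linearity of an operator then means commuting with multiplication by scalars
  (\<open>ell2_scale\<close> below).
\<close>

typedef 'v ell2 = "{f :: 'v \<Rightarrow> complex. square_summable f}"
  morphisms ell2_apply ell2_of
  using square_summable_zero by blast

lemma square_summable_ell2_apply [simp]: "square_summable (ell2_apply x)"
  using ell2_apply by blast

lemma ell2_apply_ell2_of [simp]: "square_summable f \<Longrightarrow> ell2_apply (ell2_of f) = f"
  by (simp add: ell2_of_inverse)

lemma ell2_eqI: "(\<And>v. ell2_apply x v = ell2_apply y v) \<Longrightarrow> x = y"
  by (metis ell2_apply_inject ext)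

instantiation ell2 :: (type) real_vector
begin

definition "0 = ell2_of (\<lambda>_. 0)"
definition "x + y = ell2_of (\<lambda>v. ell2_apply x v + ell2_apply y v)"
definition "x - y = ell2_of (\<lambda>v. ell2_apply x v - ell2_apply y v)"
definition "- x = ell2_of (\<lambda>v. - ell2_apply x v)"
definition "c *\<^sub>R x = ell2_of (\<lambda>v. c *\<^sub>R ell2_apply x v)"

lemma ell2_apply_simps [simp]:
  "ell2_apply 0 v = 0"
  "ell2_apply (x + y) v = ell2_apply x v + ell2_apply y v"
  "ell2_apply (x - y) v = ell2_apply x v - ell2_apply y v"
  "ell2_apply (- x) v = - ell2_apply x v"
  "ell2_apply (c *\<^sub>R x) v = c *\<^sub>R ell2_apply x v"
  by (simp_all add: zero_ell2_def plus_ell2_def minus_ell2_def uminus_ell2_def scaleR_ell2_def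
      square_summable_zero square_summable_add square_summable_diff square_summable_uminus
      square_summable_scaleR)

instance
  by standard (auto intro!: ell2_eqI simp: algebra_simps)

end

instantiation ell2 :: (type) real_inner
begin

definition "inner x y = Re (\<Sum>\<^sub>\<infinity>v. ell2_apply x v * cnj (ell2_apply y v))"
definition "norm x = sqrt (inner x x)" for x :: "'a ell2"
definition "sgn x = x /\<^sub>R norm x" for x :: "'a ell2"
definition "dist x y = norm (x - y)" for x y :: "'a ell2"
definition "uniformity = (INF e\<in>{0 <..}. principal {(x, y :: 'a ell2). dist x y < e})"
definition "open U = (\<forall>x\<in>U. \<forall>\<^sub>F (x', y) in uniformity. x' = x \<longrightarrow> y \<in> U)" for U :: "'a ell2 set"

lemma inner_ell2_summable:
  "(\<lambda>v. ell2_apply x v * cnj (ell2_apply y v)) summable_on UNIV"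
  using square_summable_ell2_apply[of x] square_summable_ell2_apply[of y]
  unfolding square_summable_def by (rule abs_summable_summable[OF abs_summable_mult_cnj])

lemma inner_ell2_self: "inner x x = (\<Sum>\<^sub>\<infinity>v. (cmod (ell2_apply x v))\<^sup>2)"
  unfolding inner_ell2_def infsum_Re[OF inner_ell2_summable, symmetric]
  by (rule infsum_cong) (simp add: cmod_power2 flip: power2_eq_square)

instance
proof
  fix x y z :: "'a ell2" and c :: real
  show "inner x y = inner y x"
  proof -
    have "(\<Sum>\<^sub>\<infinity>v. ell2_apply y v * cnj (ell2_apply x v))
        = (\<Sum>\<^sub>\<infinity>v. cnj (ell2_apply x v * cnj (ell2_apply y v)))"
      by (rule infsum_cong) (simp add: mult.commute)
    then show ?thesis unfolding inner_ell2_def infsum_cnj by simp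
  qed
  show "inner (x + y) z = inner x z + inner y z"
    by (simp add: inner_ell2_def distrib_right infsum_add inner_ell2_summable)
  show "inner (c *\<^sub>R x) y = c * inner x y"
  proof -
    have "(\<Sum>\<^sub>\<infinity>v. ell2_apply (c *\<^sub>R x) v * cnj (ell2_apply y v))
        = of_real c * (\<Sum>\<^sub>\<infinity>v. ell2_apply x v * cnj (ell2_apply y v))"
      unfolding infsum_cmult_right[OF inner_ell2_summable, symmetric]
      by (rule infsum_cong) (simp add: scaleR_conv_of_real)
    then show ?thesis unfolding inner_ell2_def by simp
  qed
  show "0 \<le> inner x x"
    unfolding inner_ell2_self by (intro infsum_nonneg) simp
  show "inner x x = 0 \<longleftrightarrow> x = 0"
  proof
    assume "inner x x = 0"
    then have "(\<Sum>\<^sub>\<infinity>v. (cmod (ell2_apply x v))\<^sup>2) \<le> 0" by (simp add: inner_ell2_self)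
    then have "(cmod (ell2_apply x v))\<^sup>2 = 0" for v
      by (rule nonneg_infsum_le_0D)
         (use square_summable_ell2_apply[of x] in \<open>auto simp: square_summable_def\<close>)
    then show "x = 0" by (intro ell2_eqI) simp
  qed (simp add: inner_ell2_def)
qed (fact norm_ell2_def sgn_ell2_def dist_ell2_def uniformity_ell2_def open_ell2_def)+

end

lemma norm_ell2_power2: "(norm x)\<^sup>2 = (\<Sum>\<^sub>\<infinity>v. (cmod (ell2_apply x v))\<^sup>2)"
  by (simp add: power2_norm_eq_inner inner_ell2_self)

lemma sum_norm_ell2_le:
  assumes "finite F"
  shows "(\<Sum>v\<in>F. (cmod (ell2_apply x v))\<^sup>2) \<le> (norm x)\<^sup>2"
  unfolding norm_ell2_power2 using square_summable_ell2_apply[of x] assms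
  by (intro finite_sum_le_infsum) (auto simp: square_summable_def)

lemma norm_ell2_apply_le: "cmod (ell2_apply x v) \<le> norm x"
  by (rule power2_le_imp_le) (use sum_norm_ell2_le[of "{v}" x] in simp_all)

lemma bounded_linear_ell2_apply: "bounded_linear (\<lambda>x. ell2_apply x v)"
  by (rule bounded_linear_intro[where K = 1]) (use norm_ell2_apply_le in auto)

text \<open>One uniform bound on finite sums yields both membership and norm. It serves wherever
  membership is not known beforehand: limits of Cauchy sequences and images under the
  Laplacian.\<close>

lemma square_summable_norm_leI:
  assumes "\<And>F. finite F \<Longrightarrow> (\<Sum>v\<in>F. (cmod (f v))\<^sup>2) \<le> B"
  shows "square_summable f" "(norm (ell2_of f))\<^sup>2 \<le> B"
proof -
  show f: "square_summable f"
    unfolding square_summable_def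
    by (rule nonneg_bdd_above_summable_on) (use assms in \<open>auto intro!: bdd_aboveI2\<close>)
  show "(norm (ell2_of f))\<^sup>2 \<le> B"
    using f assms unfolding norm_ell2_power2 ell2_apply_ell2_of[OF f]
    by (intro infsum_le_finite_sums) (auto simp: square_summable_def)
qed

text \<open>Coordinates converge by continuity of evaluation. For finite sums the bound on
  \<open>X m - X n\<close> survives \<open>m\<close> tending to infinity, which gives at once square
  summability of the pointwise limit and convergence in norm.\<close>

instance ell2 :: (type) banach
proof
  fix X :: "nat \<Rightarrow> 'a ell2"
  assume X: "Cauchy X"
  have "Cauchy (\<lambda>n. ell2_apply (X n) v)" for v
    by (rule bounded_linear.Cauchy[OF bounded_linear_ell2_apply X])
  then have "\<forall>v. \<exists>l. (\<lambda>n. ell2_apply (X n) v) \<longlonglongrightarrow> l"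
    by (simp add: Cauchy_convergent_iff convergent_def)
  then obtain g where g: "\<And>v. (\<lambda>n. ell2_apply (X n) v) \<longlonglongrightarrow> g v" by metis
  have close: "\<exists>M. \<forall>n\<ge>M. square_summable (\<lambda>v. g v - ell2_apply (X n) v) \<and>
      (norm (ell2_of (\<lambda>v. g v - ell2_apply (X n) v)))\<^sup>2 \<le> e\<^sup>2" if e: "e > 0" for e
  proof -
    obtain M where M: "\<And>m n. M \<le> m \<Longrightarrow> M \<le> n \<Longrightarrow> norm (X m - X n) < e"
      using CauchyD[OF X e] by blast
    have "(\<Sum>v\<in>F. (cmod (g v - ell2_apply (X n) v))\<^sup>2) \<le> e\<^sup>2" if n: "n \<ge> M" and F: "finite F" for n F
    proof (rule LIMSEQ_le_const2)
      show "(\<lambda>m. \<Sum>v\<in>F. (cmod (ell2_apply (X m) v - ell2_apply (X n) v))\<^sup>2)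
          \<longlonglongrightarrow> (\<Sum>v\<in>F. (cmod (g v - ell2_apply (X n) v))\<^sup>2)"
        by (intro tendsto_intros g)
      have "(\<Sum>v\<in>F. (cmod (ell2_apply (X m) v - ell2_apply (X n) v))\<^sup>2) \<le> e\<^sup>2" if "m \<ge> M" for m
        using sum_norm_ell2_le[OF F, of "X m - X n"] power_mono[of "norm (X m - X n)" e 2] M[OF that n]
        by simp
      then show "\<exists>M. \<forall>m\<ge>M. (\<Sum>v\<in>F. (cmod (ell2_apply (X m) v - ell2_apply (X n) v))\<^sup>2) \<le> e\<^sup>2"
        by blast
    qed
    then show ?thesis
      using square_summable_norm_leI[of "\<lambda>v. g v - ell2_apply (X n) v" "e\<^sup>2" for n] by metis
  qed
  obtain M where "square_summable (\<lambda>v. g v - ell2_apply (X M) v)"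
    using close[of 1] by auto
  then have gs: "square_summable g"
    using square_summable_add[of "\<lambda>v. g v - ell2_apply (X M) v" "ell2_apply (X M)"] by simp
  have diff: "ell2_of (\<lambda>v. g v - ell2_apply (X n) v) = ell2_of g - X n" for n
    by (simp add: minus_ell2_def gs)
  have "X \<longlonglongrightarrow> ell2_of g"
  proof (rule metric_LIMSEQ_I)
    fix r :: real assume r: "r > 0"
    then obtain M where "\<And>n. n \<ge> M \<Longrightarrow> (norm (ell2_of g - X n))\<^sup>2 \<le> (r / 2)\<^sup>2"
      using close[of "r / 2"] unfolding diff by auto
    then have "norm (ell2_of g - X n) \<le> r / 2" if "n \<ge> M" for n
      by (rule power2_le_imp_le) (use that r in auto)
    then have "dist (X n) (ell2_of g) < r" if "n \<ge> M" for n
      using that r by (force simp: dist_norm norm_minus_commute)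
    then show "\<exists>no. \<forall>n\<ge>no. dist (X n) (ell2_of g) < r" by blast
  qed
  then show "convergent X" by (auto simp: convergent_def)
qed

section \<open>Operators on L2\<close>

lemma L2_iff: "f \<in> L2 V \<longleftrightarrow> square_summable f \<and> (\<forall>v. v \<notin> V \<longrightarrow> f v = 0)"
proof -
  have "(\<lambda>v. (cmod (f v))\<^sup>2) summable_on V \<longleftrightarrow> (\<lambda>v. (cmod (f v))\<^sup>2) summable_on UNIV"
    if "\<forall>v. v \<notin> V \<longrightarrow> f v = 0"
    by (rule summable_on_cong_neutral) (use that in auto)
  then show ?thesis by (auto simp: L2_def square_summable_def)
qed

lemma L2_square_summable: "f \<in> L2 V \<Longrightarrow> square_summable f"
  by (simp add: L2_iff)

lemma L2_norm_eq_norm: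
  assumes f: "f \<in> L2 V"
  shows "L2_norm V f = norm (ell2_of f)"
proof -
  have "(\<Sum>\<^sub>\<infinity>v\<in>V. (cmod (f v))\<^sup>2) = (\<Sum>\<^sub>\<infinity>v. (cmod (f v))\<^sup>2)"
    by (rule infsum_cong_neutral) (use f in \<open>auto simp: L2_iff\<close>)
  then show ?thesis
    using f by (simp add: L2_norm_def norm_ell2_def inner_ell2_self L2_iff)
qed

lemma L2_inner_eq_infsum:
  assumes f: "f \<in> L2 V"
  shows "L2_inner V f g = (\<Sum>\<^sub>\<infinity>v. f v * cnj (g v))"
  unfolding L2_inner_def by (rule infsum_cong_neutral) (use f in \<open>auto simp: L2_iff\<close>)

lemma Re_L2_inner:
  assumes "f \<in> L2 V" "g \<in> L2 V"
  shows "Re (L2_inner V f g) = inner (ell2_of f) (ell2_of g)"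
  using assms by (simp add: L2_inner_eq_infsum inner_ell2_def L2_square_summable)

text \<open>The type \<open>'v ell2\<close> cannot depend on \<open>V\<close>, so it covers all of
  \<open>'v\<close> and \<open>L2 V\<close> becomes a subspace of it.\<close>

definition L2_space :: "'v set \<Rightarrow> 'v ell2 set" where
  "L2_space V = {x. \<forall>v. v \<notin> V \<longrightarrow> ell2_apply x v = 0}"

lemma L2_space_iff: "x \<in> L2_space V \<longleftrightarrow> ell2_apply x \<in> L2 V"
  by (simp add: L2_space_def L2_iff)

lemma ell2_of_in_L2_space: "f \<in> L2 V \<Longrightarrow> ell2_of f \<in> L2_space V"
  by (simp add: L2_space_iff L2_square_summable)

lemma subspace_L2_space: "subspace (L2_space V)"
  by (auto simp: subspace_def L2_space_def)

definition ell2_scale :: "complex \<Rightarrow> 'v ell2 \<Rightarrow> 'v ell2" where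
  "ell2_scale a x = ell2_of (\<lambda>v. a * ell2_apply x v)"

lemma ell2_apply_scale [simp]: "ell2_apply (ell2_scale a x) v = a * ell2_apply x v"
  by (simp add: ell2_scale_def square_summable_mult)

lemma bounded_linear_ell2_scale: "bounded_linear (ell2_scale a :: 'v ell2 \<Rightarrow> 'v ell2)"
proof (rule bounded_linear_intro[where K = "cmod a"])
  fix x :: "'v ell2"
  have "(norm (ell2_scale a x))\<^sup>2 = (norm x * cmod a)\<^sup>2"
    by (simp add: norm_ell2_power2 norm_mult power_mult_distrib infsum_cmult_right' mult.commute)
  then show "norm (ell2_scale a x) \<le> norm x * cmod a" by simp
qed (auto intro!: ell2_eqI simp: algebra_simps)

text \<open>The orthogonal projection onto \<open>L2_space V\<close>.\<close>

definition ell2_restrict :: "'v set \<Rightarrow> 'v ell2 \<Rightarrow> 'v ell2" where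
  "ell2_restrict V x = ell2_of (\<lambda>v. if v \<in> V then ell2_apply x v else 0)"

lemma restrict_in_L2: "square_summable f \<Longrightarrow> (\<lambda>v. if v \<in> V then f v else 0) \<in> L2 V"
proof -
  assume f: "square_summable f"
  have "square_summable (\<lambda>v. if v \<in> V then f v else 0)"
    unfolding square_summable_def
    by (rule summable_on_comparison_test[OF f[unfolded square_summable_def]]) auto
  then show ?thesis by (simp add: L2_iff)
qed

lemma ell2_apply_restrict [simp]:
  "ell2_apply (ell2_restrict V x) v = (if v \<in> V then ell2_apply x v else 0)"
  by (simp add: ell2_restrict_def L2_square_summable[OF restrict_in_L2])

lemma ell2_restrict_in_L2_space [simp]: "ell2_restrict V x \<in> L2_space V"
  by (simp add: L2_space_def)

lemma ell2_restrict_id: "x \<in> L2_space V \<Longrightarrow> ell2_restrict V x = x"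
  by (auto intro!: ell2_eqI simp: L2_space_def)

lemma bounded_linear_ell2_restrict: "bounded_linear (ell2_restrict V)"
proof (rule bounded_linear_intro[where K = 1])
  fix x
  have "(norm (ell2_restrict V x))\<^sup>2 \<le> (norm x)\<^sup>2"
    unfolding norm_ell2_power2
    using square_summable_ell2_apply[of "ell2_restrict V x"] square_summable_ell2_apply[of x]
    unfolding square_summable_def by (rule infsum_mono) simp
  then show "norm (ell2_restrict V x) \<le> norm x * 1"
    unfolding mult_1_right by (rule power2_le_imp_le) simp
qed (auto intro!: ell2_eqI)

lemma inner_ell2_restrict:
  assumes "x \<in> L2_space V"
  shows "inner x (ell2_restrict V y) = inner x y"
  unfolding inner_ell2_def
  by (intro arg_cong[where f = Re] infsum_cong) (use assms in \<open>auto simp: L2_space_def\<close>)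

text \<open>Operators on \<open>L2 V\<close> are extended by \<open>0\<close> on the orthogonal complement.\<close>

definition ell2_operator ::
    "'v set \<Rightarrow> (('v \<Rightarrow> complex) \<Rightarrow> 'v \<Rightarrow> complex) \<Rightarrow> 'v ell2 \<Rightarrow> 'v ell2" where
  "ell2_operator V T x = ell2_of (T (ell2_apply (ell2_restrict V x)))"

lemma bounded_operator_in_L2: "bounded_operator V T \<Longrightarrow> f \<in> L2 V \<Longrightarrow> T f \<in> L2 V"
  by (simp add: bounded_operator_def)

lemma ell2_operator_in_L2_space:
  "bounded_operator V T \<Longrightarrow> ell2_operator V T x \<in> L2_space V"
  unfolding ell2_operator_def
  by (rule ell2_of_in_L2_space, erule bounded_operator_in_L2) (simp flip: L2_space_iff)

lemma ell2_apply_operator: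
  assumes "bounded_operator V T" "x \<in> L2_space V"
  shows "ell2_apply (ell2_operator V T x) = T (ell2_apply x)"
  using bounded_operator_in_L2[OF assms(1), of "ell2_apply x"] assms(2)
  by (simp add: ell2_operator_def ell2_restrict_id L2_space_iff L2_square_summable)

lemma ell2_operator_of:
  assumes "bounded_operator V T" "f \<in> L2 V"
  shows "ell2_operator V T (ell2_of f) = ell2_of (T f)"
  using assms
  by (simp add: ell2_operator_def ell2_restrict_id ell2_of_in_L2_space L2_square_summable)

lemma ell2_operator_restrict:
  "ell2_operator V T (ell2_restrict V x) = ell2_operator V T x"
  by (simp add: ell2_operator_def ell2_restrict_id)

lemma ell2_operator_combination:
  assumes T: "bounded_operator V T"
  shows "ell2_operator V T (ell2_scale a x + ell2_scale b y)
    = ell2_scale a (ell2_operator V T x) + ell2_scale b (ell2_operator V T y)"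
proof -
  let ?f = "ell2_apply (ell2_restrict V x)" and ?g = "ell2_apply (ell2_restrict V y)"
  have fg: "?f \<in> L2 V" "?g \<in> L2 V" by (simp_all flip: L2_space_iff)
  have Tfg: "T ?f \<in> L2 V" "T ?g \<in> L2 V" by (simp_all add: bounded_operator_in_L2[OF T] fg)
  have "ell2_apply (ell2_restrict V (ell2_scale a x + ell2_scale b y)) = (\<lambda>v. a * ?f v + b * ?g v)"
    by auto
  then have "ell2_operator V T (ell2_scale a x + ell2_scale b y) = ell2_of (\<lambda>v. a * T ?f v + b * T ?g v)"
    using T fg by (simp only: ell2_operator_def bounded_operator_def)
  also have "\<dots> = ell2_scale a (ell2_operator V T x) + ell2_scale b (ell2_operator V T y)"
    using Tfg by (intro ell2_eqI)
      (simp add: ell2_operator_def L2_square_summable square_summable_add square_summable_mult)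
  finally show ?thesis .
qed

lemma ell2_scale_of_real [simp]: "ell2_scale (complex_of_real c) x = c *\<^sub>R x"
  by (rule ell2_eqI) (simp add: scaleR_conv_of_real)

lemma bounded_linear_ell2_operator:
  assumes T: "bounded_operator V T"
  shows "bounded_linear (ell2_operator V T)"
proof -
  have "\<exists>C. \<forall>f\<in>L2 V. L2_norm V (T f) \<le> C * L2_norm V f"
    using T by (simp only: bounded_operator_def)
  then obtain C where C: "\<And>f. f \<in> L2 V \<Longrightarrow> L2_norm V (T f) \<le> C * L2_norm V f"
    by blast
  obtain K where K: "K \<ge> 0" "\<And>x. norm (ell2_restrict V x) \<le> norm x * K"
    using bounded_linear.nonneg_bounded[OF bounded_linear_ell2_restrict[of V]] by blast
  show ?thesis
  proof (rule bounded_linear_intro[where K = "\<bar>C\<bar> * K"])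
    fix x y c
    show "ell2_operator V T (x + y) = ell2_operator V T x + ell2_operator V T y"
      using ell2_operator_combination[OF T, of "complex_of_real 1" x "complex_of_real 1" y]
      unfolding ell2_scale_of_real by simp
    show "ell2_operator V T (c *\<^sub>R x) = c *\<^sub>R ell2_operator V T x"
      using ell2_operator_combination[OF T, of "complex_of_real c" x "complex_of_real 0" x]
      unfolding ell2_scale_of_real by simp
    let ?f = "ell2_apply (ell2_restrict V x)"
    have f: "?f \<in> L2 V" by (simp flip: L2_space_iff)
    from f have Tf: "T ?f \<in> L2 V" by (rule bounded_operator_in_L2[OF T])
    have "norm (ell2_operator V T x) \<le> C * norm (ell2_restrict V x)"
      using C[OF f, unfolded L2_norm_eq_norm[OF f] L2_norm_eq_norm[OF Tf]]
      by (simp add: ell2_operator_def ell2_apply_inverse)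
    also have "\<dots> \<le> \<bar>C\<bar> * (norm x * K)"
      by (intro mult_mono K(2)) auto
    finally show "norm (ell2_operator V T x) \<le> norm x * (\<bar>C\<bar> * K)" by (simp add: mult_ac)
  qed
qed

lemma ell2_operator_scale:
  assumes T: "bounded_operator V T"
  shows "ell2_scale a (ell2_operator V T x) = ell2_operator V T (ell2_scale a x)"
  using ell2_operator_combination[OF T, of a x "complex_of_real 0" x]
  unfolding ell2_scale_of_real by simp

lemma selfadjoint_ell2_operator:
  assumes T: "selfadjoint_operator V T"
  shows "selfadjoint (ell2_operator V T)"
  unfolding selfadjoint_def
proof (intro conjI allI)
  have bT: "bounded_operator V T" using T by (simp add: selfadjoint_operator_def)
  then show "bounded_linear (ell2_operator V T)" by (rule bounded_linear_ell2_operator)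
  fix x y
  let ?f = "ell2_apply (ell2_restrict V x)" and ?g = "ell2_apply (ell2_restrict V y)"
  have fg: "?f \<in> L2 V" "?g \<in> L2 V" by (simp_all flip: L2_space_iff)
  have Tfg: "T ?f \<in> L2 V" "T ?g \<in> L2 V" by (simp_all add: bounded_operator_in_L2[OF bT] fg)
  note L = ell2_operator_in_L2_space[OF bT]
  have "inner (ell2_operator V T x) y = inner (ell2_operator V T x) (ell2_restrict V y)"
    by (rule inner_ell2_restrict[OF L, symmetric])
  also have "\<dots> = Re (L2_inner V (T ?f) ?g)"
    unfolding Re_L2_inner[OF Tfg(1) fg(2)] by (simp add: ell2_operator_def ell2_apply_inverse)
  also have "\<dots> = Re (L2_inner V ?f (T ?g))"
    using T fg by (simp add: selfadjoint_operator_def)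
  also have "\<dots> = inner (ell2_restrict V x) (ell2_operator V T y)"
    unfolding Re_L2_inner[OF fg(1) Tfg(2)] by (simp add: ell2_operator_def ell2_apply_inverse)
  also have "\<dots> = inner x (ell2_operator V T y)"
    unfolding inner_commute[of _ "ell2_operator V T y"] by (rule inner_ell2_restrict[OF L])
  finally show "inner (ell2_operator V T x) y = inner x (ell2_operator V T y)" .
qed

lemma nonneg_selfadjoint_ell2_operator:
  assumes T: "nonneg_selfadjoint_operator V T"
  shows "nonneg_selfadjoint (ell2_operator V T)"
  unfolding nonneg_selfadjoint_def
proof (intro conjI allI)
  have sT: "selfadjoint_operator V T" using T by (simp add: nonneg_selfadjoint_operator_def)
  then have bT: "bounded_operator V T" by (simp add: selfadjoint_operator_def)
  show "selfadjoint (ell2_operator V T)" using sT by (rule selfadjoint_ell2_operator)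
  fix x
  let ?f = "ell2_apply (ell2_restrict V x)"
  have f: "?f \<in> L2 V" by (simp flip: L2_space_iff)
  from f have Tf: "T ?f \<in> L2 V" by (rule bounded_operator_in_L2[OF bT])
  have "inner (ell2_operator V T x) x = inner (ell2_operator V T x) (ell2_restrict V x)"
    by (rule inner_ell2_restrict[OF ell2_operator_in_L2_space[OF bT], symmetric])
  also have "\<dots> = Re (L2_inner V (T ?f) ?f)"
    unfolding Re_L2_inner[OF Tf f] by (simp add: ell2_operator_def ell2_apply_inverse)
  finally show "0 \<le> inner (ell2_operator V T x) x"
    using T f by (simp add: nonneg_selfadjoint_operator_def)
qed

section \<open>From real operators on \<open>ell2\<close> back to complex operators on
  \<open>L2 V\<close>\<close>

definition L2_operator ::
    "('v ell2 \<Rightarrow> 'v ell2) \<Rightarrow> ('v \<Rightarrow> complex) \<Rightarrow> 'v \<Rightarrow> complex" where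
  "L2_operator R f = ell2_apply (R (ell2_of f))"

text \<open>Re <f, i g> = Re (-i <f, g>). The complex inner product is thus recovered from the real
  one, and real symmetry together with commutation with scalars gives complex
  self-adjointness.\<close>

lemma Im_L2_inner:
  assumes f: "f \<in> L2 V" and g: "g \<in> L2 V"
  shows "Im (L2_inner V f g) = inner (ell2_of f) (ell2_scale \<i> (ell2_of g))"
proof -
  have "inner (ell2_of f) (ell2_scale \<i> (ell2_of g)) = Re (\<Sum>\<^sub>\<infinity>v. - \<i> * (f v * cnj (g v)))"
    using f g unfolding inner_ell2_def
    by (intro arg_cong[where f = Re] infsum_cong) (simp add: L2_square_summable)
  then show ?thesis
    unfolding infsum_cmult_right' L2_inner_eq_infsum[OF f] by simp
qed

text \<open>The assumption \<open>scale\<close> supplies complex linearity and the imaginary part of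
  the symmetry; \<open>restrict\<close> keeps the operator inside \<open>L2 V\<close>.\<close>

lemma nonneg_selfadjoint_L2_operator:
  assumes R: "nonneg_selfadjoint R"
    and scale: "\<And>a x. ell2_scale a (R x) = R (ell2_scale a x)"
    and restrict: "\<And>x. ell2_restrict V (R x) = R (ell2_restrict V x)"
  shows "nonneg_selfadjoint_operator V (L2_operator R)"
proof -
  have blR: "bounded_linear R" and symR: "\<And>x y. inner (R x) y = inner x (R y)"
    and posR: "\<And>x. 0 \<le> inner (R x) x"
    using R by (auto simp: nonneg_selfadjoint_def selfadjoint_def)
  have in_L2: "L2_operator R f \<in> L2 V" if "f \<in> L2 V" for f
    using restrict[of "ell2_of f"] ell2_restrict_in_L2_space[of V "R (ell2_of f)"] that
    by (simp add: L2_operator_def ell2_restrict_id ell2_of_in_L2_space flip: L2_space_iff)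
  have of_op: "ell2_of (L2_operator R f) = R (ell2_of f)" for f
    by (simp add: L2_operator_def ell2_apply_inverse)
  show ?thesis
    unfolding nonneg_selfadjoint_operator_def selfadjoint_operator_def bounded_operator_def
  proof (intro conjI ballI allI)
    fix f g a b assume f: "f \<in> L2 V" and g: "g \<in> L2 V"
    have "ell2_of (\<lambda>v. a * f v + b * g v) = ell2_scale a (ell2_of f) + ell2_scale b (ell2_of g)"
      using f g by (intro ell2_eqI) (simp add: L2_square_summable square_summable_add square_summable_mult)
    then show "L2_operator R (\<lambda>v. a * f v + b * g v)
        = (\<lambda>v. a * L2_operator R f v + b * L2_operator R g v)"
      unfolding L2_operator_def
      by (simp add: bounded_linear.linear[OF blR, THEN linear_add] fun_eq_iff flip: scale)
  next
    obtain K where K: "\<And>x. norm (R x) \<le> norm x * K"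
      using bounded_linear.bounded[OF blR] by blast
    show "\<exists>C. \<forall>f\<in>L2 V. L2_norm V (L2_operator R f) \<le> C * L2_norm V f"
      using K by (intro exI[of _ K]) (auto simp: L2_norm_eq_norm in_L2 of_op mult.commute)
  next
    fix f g assume f: "f \<in> L2 V" and g: "g \<in> L2 V"
    show "L2_inner V (L2_operator R f) g = L2_inner V f (L2_operator R g)"
      by (rule complex_eqI)
         (simp_all add: Re_L2_inner Im_L2_inner f g in_L2 of_op symR scale)
  next
    fix f assume f: "f \<in> L2 V"
    show "0 \<le> Re (L2_inner V (L2_operator R f) f)"
      using posR by (simp add: Re_L2_inner f in_L2 of_op)
  qed (rule in_L2)
qed

text \<open>The choice in \<open>operator_sqrt\<close> is legitimate once one root exists. The root
  of the extended operator commutes with everything that commutes with it, in particular with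
  complex scalars and with restriction to \<open>V\<close>, and so descends to
  \<open>L2 V\<close>.\<close>

lemma operator_sqrt:
  assumes T: "nonneg_selfadjoint_operator V T"
  shows "nonneg_selfadjoint_operator V (operator_sqrt V T)"
    and "\<forall>f\<in>L2 V. operator_sqrt V T (operator_sqrt V T f) = T f"
proof -
  let ?T = "ell2_operator V T"
  have bT: "bounded_operator V T"
    using T by (simp add: nonneg_selfadjoint_operator_def selfadjoint_operator_def)
  obtain R where R: "nonneg_selfadjoint R" and RR: "\<And>x. R (R x) = ?T x"
    and comm: "\<And>S x. bounded_linear S \<Longrightarrow> (\<And>x. S (?T x) = ?T (S x)) \<Longrightarrow> S (R x) = R (S x)"
    using nonneg_selfadjoint_sqrt[OF nonneg_selfadjoint_ell2_operator[OF T]] by blast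
  have "ell2_scale a (R x) = R (ell2_scale a x)" for a x
    by (rule comm[OF bounded_linear_ell2_scale]) (rule ell2_operator_scale[OF bT])
  moreover have "ell2_restrict V (R x) = R (ell2_restrict V x)" for x
    by (rule comm[OF bounded_linear_ell2_restrict])
       (simp add: ell2_operator_restrict ell2_restrict_id ell2_operator_in_L2_space[OF bT])
  ultimately have "nonneg_selfadjoint_operator V (L2_operator R)"
    using R by (intro nonneg_selfadjoint_L2_operator)
  moreover have "L2_operator R (L2_operator R f) = T f" if "f \<in> L2 V" for f
    using ell2_apply_operator[OF bT ell2_of_in_L2_space[OF that]] that
    by (simp add: L2_operator_def ell2_apply_inverse RR L2_square_summable)
  ultimately have "\<exists>R. nonneg_selfadjoint_operator V R \<and> (\<forall>f\<in>L2 V. R (R f) = T f)"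
    by blast
  from someI_ex[OF this] show "nonneg_selfadjoint_operator V (operator_sqrt V T)"
    and "\<forall>f\<in>L2 V. operator_sqrt V T (operator_sqrt V T f) = T f"
    unfolding operator_sqrt_def by blast+
qed

section \<open>The graph Laplacian\<close>

text \<open>Lets a finite \<open>V\<close> and the finite blocks \<Omega> share the theory of
  bounded degrees with infinite graphs.\<close>

lemma finite_imp_bounded_degrees:
  assumes V: "finite V"
  shows "bounded_degrees V w"
proof -
  have "\<forall>v\<in>V. (\<Sum>\<^sub>\<infinity>u\<in>V. w u v) \<le> (\<Sum>v\<in>V. \<bar>\<Sum>u\<in>V. w u v\<bar>)"
  proof
    fix v assume "v \<in> V"
    then have "\<bar>\<Sum>u\<in>V. w u v\<bar> \<le> (\<Sum>v\<in>V. \<bar>\<Sum>u\<in>V. w u v\<bar>)"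
      using V by (intro member_le_sum) auto
    then show "(\<Sum>\<^sub>\<infinity>u\<in>V. w u v) \<le> (\<Sum>v\<in>V. \<bar>\<Sum>u\<in>V. w u v\<bar>)"
      using V by simp
  qed
  then show ?thesis
    unfolding bounded_degrees_def using V by (intro exI[of _ "\<Sum>v\<in>V. \<bar>\<Sum>u\<in>V. w u v\<bar>"]) simp
qed

text \<open>Degrees are summed over the second argument, as in \<open>laplacian\<close>. Positivity
  of \<open>c\<close>, which will be divided by, is arranged by passing to
  \<open>max c 1\<close>.\<close>

locale bounded_graph =
  fixes V :: "'v set" and w :: "'v \<Rightarrow> 'v \<Rightarrow> real" and c :: real
  assumes w_nonneg: "u \<in> V \<Longrightarrow> v \<in> V \<Longrightarrow> 0 \<le> w u v"
    and w_sym: "u \<in> V \<Longrightarrow> v \<in> V \<Longrightarrow> w u v = w v u"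
    and degree_summable: "v \<in> V \<Longrightarrow> (\<lambda>u. w v u) summable_on V"
    and degree_le: "v \<in> V \<Longrightarrow> (\<Sum>\<^sub>\<infinity>u\<in>V. w v u) \<le> c"
    and c_pos: "0 < c"

lemma bounded_graphI:
  assumes w: "weighted_graph V w" and b: "bounded_degrees V w"
  obtains c where "bounded_graph V w c"
proof -
  obtain c where c: "\<And>v. v \<in> V \<Longrightarrow> (\<lambda>u. w u v) summable_on V"
    "\<And>v. v \<in> V \<Longrightarrow> (\<Sum>\<^sub>\<infinity>u\<in>V. w u v) \<le> c"
    using b unfolding bounded_degrees_def by metis
  have sym: "w u v = w v u" if "u \<in> V" "v \<in> V" for u v
    using w that by (simp add: weighted_graph_def)
  have s: "(\<lambda>u. w v u) summable_on V \<longleftrightarrow> (\<lambda>u. w u v) summable_on V" if "v \<in> V" for v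
    by (rule summable_on_cong) (rule sym[OF that])
  have i: "(\<Sum>\<^sub>\<infinity>u\<in>V. w v u) = (\<Sum>\<^sub>\<infinity>u\<in>V. w u v)" if "v \<in> V" for v
    by (rule infsum_cong) (rule sym[OF that])
  have "bounded_graph V w (max c 1)"
  proof
    fix u v assume uv: "u \<in> V" "v \<in> V"
    show "0 \<le> w u v" using w uv by (simp add: weighted_graph_def)
    show "w u v = w v u" using sym uv .
  next
    fix v assume v: "v \<in> V"
    show "(\<lambda>u. w v u) summable_on V" using s[OF v] c(1)[OF v] by simp
    show "(\<Sum>\<^sub>\<infinity>u\<in>V. w v u) \<le> max c 1" using i[OF v] c(2)[OF v] by simp
  qed simp
  then show thesis by (rule that)
qed

context bounded_graph
begin

lemma laplacian_outside: "v \<notin> V \<Longrightarrow> laplacian V w f v = 0"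
  by (simp add: laplacian_def)

text \<open>A finite set of pairs is enlarged to a rectangle, where each row sum is at most the
  degree bound \<open>c\<close>. All later summability over \<open>V \<times> V\<close> is by
  comparison with this family and its transpose.\<close>

lemma vertex_energy:
  assumes f: "f \<in> L2 V"
  shows "(\<lambda>(v, u). (cmod (f v))\<^sup>2 * w v u) summable_on V \<times> V"
    and "(\<Sum>\<^sub>\<infinity>(v, u)\<in>V \<times> V. (cmod (f v))\<^sup>2 * w v u) \<le> c * (norm (ell2_of f))\<^sup>2"
proof -
  have le: "(\<Sum>(v, u)\<in>F. (cmod (f v))\<^sup>2 * w v u) \<le> c * (norm (ell2_of f))\<^sup>2"
    if F: "finite F" "F \<subseteq> V \<times> V" for F
  proof -
    let ?A = "fst ` F" and ?B = "snd ` F"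
    have fin: "finite ?A" "finite ?B" and sub: "?A \<subseteq> V" "?B \<subseteq> V" using F by auto
    have "(\<Sum>(v, u)\<in>F. (cmod (f v))\<^sup>2 * w v u) \<le> (\<Sum>(v, u)\<in>?A \<times> ?B. (cmod (f v))\<^sup>2 * w v u)"
      using fin sub by (intro sum_mono2) (force intro!: mult_nonneg_nonneg w_nonneg)+
    also have "\<dots> = (\<Sum>v\<in>?A. (cmod (f v))\<^sup>2 * (\<Sum>u\<in>?B. w v u))"
      by (simp add: sum.cartesian_product sum_distrib_left)
    also have "\<dots> \<le> (\<Sum>v\<in>?A. (cmod (f v))\<^sup>2 * c)"
    proof (intro sum_mono mult_left_mono)
      fix v assume "v \<in> ?A"
      then have v: "v \<in> V" using sub by auto
      have "(\<Sum>u\<in>?B. w v u) \<le> (\<Sum>\<^sub>\<infinity>u\<in>V. w v u)"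
        using fin sub v by (intro finite_sum_le_infsum degree_summable) (auto intro: w_nonneg)
      then show "(\<Sum>u\<in>?B. w v u) \<le> c" using degree_le[OF v] by linarith
    qed simp
    also have "\<dots> = c * (\<Sum>v\<in>?A. (cmod (ell2_apply (ell2_of f) v))\<^sup>2)"
      using f by (simp add: L2_square_summable sum_distrib_left mult.commute)
    also have "\<dots> \<le> c * (norm (ell2_of f))\<^sup>2"
      using c_pos by (intro mult_left_mono sum_norm_ell2_le fin) simp
    finally show ?thesis .
  qed
  show summ: "(\<lambda>(v, u). (cmod (f v))\<^sup>2 * w v u) summable_on V \<times> V"
  proof (rule nonneg_bdd_above_summable_on)
    show "0 \<le> (case x of (v, u) \<Rightarrow> (cmod (f v))\<^sup>2 * w v u)" if "x \<in> V \<times> V" for x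
      using that by (auto simp: w_nonneg)
    show "bdd_above (sum (\<lambda>(v, u). (cmod (f v))\<^sup>2 * w v u) ` {F. F \<subseteq> V \<times> V \<and> finite F})"
      using le by (intro bdd_aboveI2[where M = "c * (norm (ell2_of f))\<^sup>2"]) blast
  qed
  show "(\<Sum>\<^sub>\<infinity>(v, u)\<in>V \<times> V. (cmod (f v))\<^sup>2 * w v u) \<le> c * (norm (ell2_of f))\<^sup>2"
    by (rule infsum_le_finite_sums[OF summ le])
qed

lemma infsum_prod_swap:
  fixes h :: "'v \<Rightarrow> 'v \<Rightarrow> 'b::banach"
  shows "(\<Sum>\<^sub>\<infinity>(v, u)\<in>V \<times> V. h u v) = (\<Sum>\<^sub>\<infinity>(v, u)\<in>V \<times> V. h v u)"
proof -
  have "bij_betw prod.swap (V \<times> V) (V \<times> V)" by (auto simp: bij_betw_def)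
  from infsum_reindex_bij_betw[OF this, of "\<lambda>(v, u). h v u"] show ?thesis
    by (simp add: case_prod_unfold)
qed

lemma vertex_energy_swapped:
  assumes f: "f \<in> L2 V"
  shows "(\<lambda>(v, u). (cmod (f u))\<^sup>2 * w v u) summable_on V \<times> V"
    and "(\<Sum>\<^sub>\<infinity>(v, u)\<in>V \<times> V. (cmod (f u))\<^sup>2 * w v u) \<le> c * (norm (ell2_of f))\<^sup>2"
proof -
  have "(\<lambda>(v, u). (cmod (f u))\<^sup>2 * w u v) summable_on V \<times> V"
    using vertex_energy(1)[OF f] by (subst summable_on_swap) simp
  then show "(\<lambda>(v, u). (cmod (f u))\<^sup>2 * w v u) summable_on V \<times> V"
    by (rule summable_on_cong[THEN iffD1, rotated]) (auto simp: w_sym)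
  have "(\<Sum>\<^sub>\<infinity>(v, u)\<in>V \<times> V. (cmod (f u))\<^sup>2 * w v u) = (\<Sum>\<^sub>\<infinity>(v, u)\<in>V \<times> V. (cmod (f u))\<^sup>2 * w u v)"
    by (rule infsum_cong) (auto simp: w_sym)
  also have "\<dots> = (\<Sum>\<^sub>\<infinity>(v, u)\<in>V \<times> V. (cmod (f v))\<^sup>2 * w v u)"
    by (rule infsum_prod_swap)
  finally show "(\<Sum>\<^sub>\<infinity>(v, u)\<in>V \<times> V. (cmod (f u))\<^sup>2 * w v u) \<le> c * (norm (ell2_of f))\<^sup>2"
    using vertex_energy(2)[OF f] by simp
qed

text \<open>Ordered pairs are summed, so every edge counts twice and the quadratic form of the
  Laplacian is half the energy.\<close>

definition energy :: "('v \<Rightarrow> complex) \<Rightarrow> real" where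
  "energy f = (\<Sum>\<^sub>\<infinity>(v, u)\<in>V \<times> V. (cmod (f v - f u))\<^sup>2 * w v u)"

text \<open>From |a - b|^2 \<le> 2 |a|^2 + 2 |b|^2: each of the two vertex energies contributes
  \<open>2 * c\<close>.\<close>

lemma energy_bound:
  assumes f: "f \<in> L2 V"
  shows "(\<lambda>(v, u). (cmod (f v - f u))\<^sup>2 * w v u) summable_on V \<times> V"
    and "energy f \<le> 4 * c * (norm (ell2_of f))\<^sup>2"
proof -
  let ?h = "\<lambda>(v, u). 2 * ((cmod (f v))\<^sup>2 * w v u) + 2 * ((cmod (f u))\<^sup>2 * w v u)"
  note s1 = vertex_energy[OF f] and s2 = vertex_energy_swapped[OF f]
  have h: "((\<lambda>x. 2 * (case x of (v, u) \<Rightarrow> (cmod (f v))\<^sup>2 * w v u)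
      + 2 * (case x of (v, u) \<Rightarrow> (cmod (f u))\<^sup>2 * w v u)) has_sum
      2 * (\<Sum>\<^sub>\<infinity>(v, u)\<in>V \<times> V. (cmod (f v))\<^sup>2 * w v u) +
      2 * (\<Sum>\<^sub>\<infinity>(v, u)\<in>V \<times> V. (cmod (f u))\<^sup>2 * w v u)) (V \<times> V)"
    by (intro has_sum_add has_sum_cmult_right has_sum_infsum s1(1) s2(1))
  have h: "(?h has_sum 2 * (\<Sum>\<^sub>\<infinity>(v, u)\<in>V \<times> V. (cmod (f v))\<^sup>2 * w v u) +
      2 * (\<Sum>\<^sub>\<infinity>(v, u)\<in>V \<times> V. (cmod (f u))\<^sup>2 * w v u)) (V \<times> V)"
    using h by (simp add: case_prod_unfold)
  have le: "(case x of (v, u) \<Rightarrow> (cmod (f v - f u))\<^sup>2 * w v u) \<le> ?h x" if "x \<in> V \<times> V" for x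
  proof -
    obtain v u where x: "x = (v, u)" "v \<in> V" "u \<in> V" using \<open>x \<in> V \<times> V\<close> by auto
    have "(cmod (f v - f u))\<^sup>2 * w v u \<le> (2 * (cmod (f v))\<^sup>2 + 2 * (cmod (f u))\<^sup>2) * w v u"
      using x by (intro mult_right_mono norm_diff_power2_le w_nonneg)
    then show ?thesis unfolding x(1) by (simp add: algebra_simps)
  qed
  show summ: "(\<lambda>(v, u). (cmod (f v - f u))\<^sup>2 * w v u) summable_on V \<times> V"
    by (rule summable_on_comparison_test[OF has_sum_imp_summable[OF h] le])
       (auto simp: w_nonneg)
  have "energy f \<le> infsum ?h (V \<times> V)"
    unfolding energy_def by (rule infsum_mono[OF summ has_sum_imp_summable[OF h] le])
  also have "\<dots> \<le> 4 * c * (norm (ell2_of f))\<^sup>2"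
    using infsumI[OF h] s1(2) s2(2) by simp
  finally show "energy f \<le> 4 * c * (norm (ell2_of f))\<^sup>2" .
qed

lemma energy_nonneg: "0 \<le> energy f"
  unfolding energy_def by (rule infsum_nonneg) (auto simp: w_nonneg)

text \<open>By a \<le> a^2 + 1 the series is dominated by a row of the energy plus the degree of
  \<open>v\<close>.\<close>

lemma laplacian_summable:
  assumes f: "f \<in> L2 V" and v: "v \<in> V"
  shows "(\<lambda>u. (f v - f u) * complex_of_real (w v u)) summable_on V"
proof (rule abs_summable_summable, rule summable_on_comparison_test)
  have "(\<lambda>u. (cmod (f v - f u))\<^sup>2 * w v u) summable_on V"
    using summable_on_SigmaD1[OF energy_bound(1)[OF f] v] .
  then show "(\<lambda>u. (cmod (f v - f u))\<^sup>2 * w v u + w v u) summable_on V"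
    using degree_summable[OF v] by (rule summable_on_add)
  fix u assume u: "u \<in> V"
  let ?a = "cmod (f v - f u)"
  have "?a \<le> ?a\<^sup>2 + 1"
    using zero_le_power2[of "?a - 1/2"] by (simp add: power2_eq_square algebra_simps)
  then have "?a * w v u \<le> (?a\<^sup>2 + 1) * w v u"
    using v u by (intro mult_right_mono w_nonneg)
  then show "norm ((f v - f u) * complex_of_real (w v u)) \<le> ?a\<^sup>2 * w v u + w v u"
    using w_nonneg[OF v u] by (simp add: norm_mult distrib_right)
qed simp

lemma edge_product_le:
  assumes vu: "v \<in> V" "u \<in> V"
  shows "norm ((f v - f u) * cnj z * complex_of_real (w v u))
    \<le> (cmod (f v - f u))\<^sup>2 * w v u + (cmod z)\<^sup>2 * w v u"
proof -
  let ?a = "cmod (f v - f u)" and ?b = "cmod z"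
  have "?a * ?b \<le> ?a\<^sup>2 + ?b\<^sup>2"
    using sum_squares_bound[of ?a ?b] mult_nonneg_nonneg[OF norm_ge_zero norm_ge_zero, of "f v - f u" z]
    by linarith
  then have "?a * ?b * w v u \<le> (?a\<^sup>2 + ?b\<^sup>2) * w v u"
    using vu by (intro mult_right_mono w_nonneg)
  then show ?thesis using w_nonneg[OF vu] by (simp add: norm_mult distrib_right)
qed

lemma edge_product_summable:
  assumes f: "f \<in> L2 V" and g: "g \<in> L2 V"
  shows "(\<lambda>(v, u). (f v - f u) * cnj (g v) * complex_of_real (w v u)) summable_on V \<times> V"
    and "(\<lambda>(v, u). (f v - f u) * cnj (g u) * complex_of_real (w v u)) summable_on V \<times> V"
proof -
  show "(\<lambda>(v, u). (f v - f u) * cnj (g v) * complex_of_real (w v u)) summable_on V \<times> V"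
    by (rule abs_summable_summable, rule summable_on_comparison_test,
        rule summable_on_add[OF energy_bound(1)[OF f] vertex_energy(1)[OF g]])
       (use edge_product_le in auto)
  show "(\<lambda>(v, u). (f v - f u) * cnj (g u) * complex_of_real (w v u)) summable_on V \<times> V"
    by (rule abs_summable_summable, rule summable_on_comparison_test,
        rule summable_on_add[OF energy_bound(1)[OF f] vertex_energy_swapped(1)[OF g]])
       (use edge_product_le in auto)
qed

section \<open>Green's formula and boundedness of the Laplacian\<close>

definition dirichlet_form :: "('v \<Rightarrow> complex) \<Rightarrow> ('v \<Rightarrow> complex) \<Rightarrow> complex" where
  "dirichlet_form f g =
     (\<Sum>\<^sub>\<infinity>(v, u)\<in>V \<times> V. (f v - f u) * cnj (g v - g u) * complex_of_real (w v u))"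

text \<open>Green's formula. Exchanging \<open>u\<close> and \<open>v\<close> changes the sign of
  the difference of \<open>f\<close>, so the sum with \<open>g v\<close> is minus the sum with
  \<open>g u\<close>, and the form is twice the former. Summability over \<open>V \<times> V\<close>
  justifies passing from iterated to double sums.\<close>

lemma laplacian_dirichlet_form:
  assumes f: "f \<in> L2 V" and g: "g \<in> L2 V"
  shows "2 * (\<Sum>\<^sub>\<infinity>v\<in>V. laplacian V w f v * cnj (g v)) = dirichlet_form f g"
proof -
  let ?F = "\<lambda>v u. (f v - f u) * cnj (g v) * complex_of_real (w v u)"
  let ?G = "\<lambda>v u. (f v - f u) * cnj (g u) * complex_of_real (w v u)"
  have "(\<Sum>\<^sub>\<infinity>v\<in>V. laplacian V w f v * cnj (g v)) = (\<Sum>\<^sub>\<infinity>v\<in>V. \<Sum>\<^sub>\<infinity>u\<in>V. ?F v u)"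
  proof (rule infsum_cong)
    fix v assume v: "v \<in> V"
    have "(\<Sum>\<^sub>\<infinity>u\<in>V. ?F v u) = (\<Sum>\<^sub>\<infinity>u\<in>V. (f v - f u) * complex_of_real (w v u) * cnj (g v))"
      by (rule infsum_cong) simp
    also have "\<dots> = laplacian V w f v * cnj (g v)"
      using v by (simp add: laplacian_def infsum_cmult_left[OF laplacian_summable[OF f v]])
    finally show "laplacian V w f v * cnj (g v) = (\<Sum>\<^sub>\<infinity>u\<in>V. ?F v u)" by simp
  qed
  also have "\<dots> = (\<Sum>\<^sub>\<infinity>(v, u)\<in>V \<times> V. ?F v u)"
    by (rule infsum_Sigma'_banach[OF edge_product_summable(1)[OF f g]])
  finally have 1: "(\<Sum>\<^sub>\<infinity>v\<in>V. laplacian V w f v * cnj (g v)) = (\<Sum>\<^sub>\<infinity>(v, u)\<in>V \<times> V. ?F v u)" .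
  have "(\<Sum>\<^sub>\<infinity>(v, u)\<in>V \<times> V. ?F v u) = (\<Sum>\<^sub>\<infinity>(v, u)\<in>V \<times> V. ?F u v)"
    by (rule infsum_prod_swap[symmetric])
  also have "\<dots> = (\<Sum>\<^sub>\<infinity>x\<in>V \<times> V. - (case x of (v, u) \<Rightarrow> ?G v u))"
    by (rule infsum_cong) (auto simp: w_sym algebra_simps)
  also have "\<dots> = - (\<Sum>\<^sub>\<infinity>(v, u)\<in>V \<times> V. ?G v u)"
    by (rule infsum_uminus)
  finally have 2: "(\<Sum>\<^sub>\<infinity>(v, u)\<in>V \<times> V. ?F v u) = - (\<Sum>\<^sub>\<infinity>(v, u)\<in>V \<times> V. ?G v u)" .
  have "dirichlet_form f g
      = (\<Sum>\<^sub>\<infinity>x\<in>V \<times> V. (case x of (v, u) \<Rightarrow> ?F v u) + - (case x of (v, u) \<Rightarrow> ?G v u))"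
    unfolding dirichlet_form_def by (rule infsum_cong) (auto simp: algebra_simps)
  also have "\<dots> = (\<Sum>\<^sub>\<infinity>(v, u)\<in>V \<times> V. ?F v u) + (\<Sum>\<^sub>\<infinity>x\<in>V \<times> V. - (case x of (v, u) \<Rightarrow> ?G v u))"
    using edge_product_summable[OF f g] by (intro infsum_add) (simp_all add: summable_on_uminus)
  also have "\<dots> = 2 * (\<Sum>\<^sub>\<infinity>(v, u)\<in>V \<times> V. ?F v u)"
    unfolding infsum_uminus 2 by simp
  finally show ?thesis unfolding 1 by simp
qed

lemma dirichlet_form_cnj: "cnj (dirichlet_form f g) = dirichlet_form g f"
  unfolding dirichlet_form_def infsum_cnj[symmetric] by (rule infsum_cong) auto

lemma dirichlet_form_self:
  assumes f: "f \<in> L2 V"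
  shows "dirichlet_form f f = complex_of_real (energy f)"
proof -
  have eq: "z * cnj z * complex_of_real t = complex_of_real ((cmod z)\<^sup>2 * t)" for z t
    by (simp only: of_real_mult complex_norm_square)
  have "dirichlet_form f f
      = (\<Sum>\<^sub>\<infinity>x\<in>V \<times> V. complex_of_real (case x of (v, u) \<Rightarrow> (cmod (f v - f u))\<^sup>2 * w v u))"
    unfolding dirichlet_form_def
    by (rule infsum_cong, clarify) (simp only: prod.case eq)
  also have "\<dots> = complex_of_real (energy f)"
    unfolding energy_def
    by (intro infsumI has_sum_of_real has_sum_infsum energy_bound(1) f)
  finally show ?thesis .
qed

text \<open>Cauchy-Schwarz in additive form, from a b \<le> t a^2 / 2 + b^2 / (2 t) on each edge;
  the weight \<open>t\<close> is left free so that one of the two energies can later be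
  absorbed.\<close>

lemma norm_dirichlet_form_le:
  assumes f: "f \<in> L2 V" and g: "g \<in> L2 V" and t: "t > 0"
  shows "2 * cmod (dirichlet_form f g) \<le> t * energy f + energy g / t"
proof -
  let ?h = "\<lambda>x. (t/2) * (case x of (v, u) \<Rightarrow> (cmod (f v - f u))\<^sup>2 * w v u)
      + (1/(2*t)) * (case x of (v, u) \<Rightarrow> (cmod (g v - g u))\<^sup>2 * w v u)"
  have h: "(?h has_sum (t/2) * energy f + (1/(2*t)) * energy g) (V \<times> V)"
    unfolding energy_def
    by (intro has_sum_add has_sum_cmult_right has_sum_infsum energy_bound(1) f g)
  have le: "norm (case x of (v, u) \<Rightarrow> (f v - f u) * cnj (g v - g u) * complex_of_real (w v u)) \<le> ?h x"
    if "x \<in> V \<times> V" for x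
  proof -
    obtain v u where x: "x = (v, u)" "v \<in> V" "u \<in> V" using \<open>x \<in> V \<times> V\<close> by auto
    let ?a = "cmod (f v - f u)" and ?b = "cmod (g v - g u)"
    have "0 \<le> (t * ?a - ?b)\<^sup>2 / (2 * t)" using t by simp
    then have "?a * ?b \<le> (t/2) * ?a\<^sup>2 + (1/(2*t)) * ?b\<^sup>2"
      using t by (simp add: power2_eq_square field_simps)
    then have "?a * ?b * w v u \<le> ((t/2) * ?a\<^sup>2 + (1/(2*t)) * ?b\<^sup>2) * w v u"
      using x by (intro mult_right_mono w_nonneg)
    moreover have "norm ((f v - f u) * cnj (g v - g u) * complex_of_real (w v u)) = ?a * ?b * w v u"
      by (simp only: norm_mult complex_mod_cnj norm_of_real abs_of_nonneg[OF w_nonneg[OF x(2,3)]])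
    ultimately show ?thesis
      unfolding x(1) prod.case by (simp only: distrib_right mult.assoc)
  qed
  have summ: "(\<lambda>(v, u). (f v - f u) * cnj (g v - g u) * complex_of_real (w v u)) summable_on V \<times> V"
    by (rule abs_summable_summable,
        rule summable_on_comparison_test[OF has_sum_imp_summable[OF h] le norm_ge_zero])
  have "cmod (dirichlet_form f g) \<le> (t/2) * energy f + (1/(2*t)) * energy g"
    unfolding dirichlet_form_def by (rule norm_infsum_le[OF has_sum_infsum[OF summ] h le])
  then show ?thesis using t by (simp add: field_simps)
qed

text \<open>
  Testing \<open>\<L> f\<close> against its own restriction to a finite set \<open>F\<close> bounds
  \<open>\<parallel>\<L> f\<parallel>\<close> on \<open>F\<close> before it is known that \<open>\<L> f\<close> is square summable.
\<close>

lemma laplacian_in_L2: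
  assumes f: "f \<in> L2 V"
  shows "laplacian V w f \<in> L2 V" and "L2_norm V (laplacian V w f) \<le> 2 * c * L2_norm V f"
proof -
  have bound: "(\<Sum>v\<in>F. (cmod (laplacian V w f v))\<^sup>2) \<le> (2 * c * norm (ell2_of f))\<^sup>2" if F: "finite F" for F
  proof -
    let ?g = "\<lambda>v. if v \<in> F then laplacian V w f v else 0"
    let ?S = "\<Sum>v\<in>F. (cmod (laplacian V w f v))\<^sup>2"
    have "square_summable ?g"
      unfolding square_summable_def
      by (rule finite_nonzero_values_imp_summable_on) (use F in \<open>auto intro: finite_subset[OF _ F]\<close>)
    then have g: "?g \<in> L2 V" by (auto simp: L2_iff laplacian_def)
    have S: "?S = (norm (ell2_of ?g))\<^sup>2"
    proof -
      have "(\<Sum>\<^sub>\<infinity>v. (cmod (?g v))\<^sup>2) = (\<Sum>\<^sub>\<infinity>v\<in>F. (cmod (?g v))\<^sup>2)"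
        by (rule infsum_cong_neutral) auto
      then show ?thesis using F g by (simp add: norm_ell2_power2 L2_square_summable)
    qed
    have "(\<Sum>\<^sub>\<infinity>v\<in>V. laplacian V w f v * cnj (?g v)) = (\<Sum>\<^sub>\<infinity>v\<in>F. laplacian V w f v * cnj (?g v))"
      by (rule infsum_cong_neutral) (auto simp: laplacian_def)
    also have "\<dots> = complex_of_real ?S"
      using F by (simp add: complex_norm_square del: of_real_power)
    finally have "dirichlet_form f ?g = 2 * complex_of_real ?S"
      using laplacian_dirichlet_form[OF f g] by simp
    then have "2 * \<bar>?S\<bar> = cmod (dirichlet_form f ?g)" by (simp only: norm_mult norm_of_real) simp
    \<comment> \<open>With the weight \<open>2 * c\<close> the energy of the test function
      contributes at most \<open>2 * ?S\<close>, which the left side absorbs; what remains is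
      exactly the bound \<open>2 * c\<close> on the norm.\<close>
    then have "4 * ?S \<le> (2 * c) * energy f + energy ?g / (2 * c)"
      using norm_dirichlet_form_le[OF f g, of "2 * c"] c_pos by simp
    also have "\<dots> \<le> (2 * c) * (4 * c * (norm (ell2_of f))\<^sup>2) + (4 * c * ?S) / (2 * c)"
      using energy_bound(2)[OF f] energy_bound(2)[OF g] c_pos unfolding S
      by (intro add_mono mult_left_mono divide_right_mono) auto
    also have "\<dots> = 8 * c\<^sup>2 * (norm (ell2_of f))\<^sup>2 + 2 * ?S"
      using c_pos by (simp add: power2_eq_square)
    finally show ?thesis by (simp add: power_mult_distrib)
  qed
  note sq = square_summable_norm_leI[OF bound]
  show Lf: "laplacian V w f \<in> L2 V" 
    by (simp only: L2_iff) (use sq(1) in \<open>auto simp: laplacian_outside\<close>)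
  show "L2_norm V (laplacian V w f) \<le> 2 * c * L2_norm V f"
    unfolding L2_norm_eq_norm[OF f] L2_norm_eq_norm[OF Lf]
    by (rule power2_le_imp_le[OF sq(2)]) (use c_pos in auto)
qed

lemma L2_inner_laplacian:
  assumes f: "f \<in> L2 V" and g: "g \<in> L2 V"
  shows "L2_inner V (laplacian V w f) g = dirichlet_form f g / 2"
  using laplacian_dirichlet_form[OF f g] by (simp add: L2_inner_def field_simps)

lemma laplacian_linear:
  assumes f: "f \<in> L2 V" and g: "g \<in> L2 V"
  shows "laplacian V w (\<lambda>v. a * f v + b * g v)
    = (\<lambda>v. a * laplacian V w f v + b * laplacian V w g v)"
proof
  fix v
  show "laplacian V w (\<lambda>v. a * f v + b * g v) v = a * laplacian V w f v + b * laplacian V w g v"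
  proof (cases "v \<in> V")
    case True
    have "((\<lambda>u. a * ((f v - f u) * complex_of_real (w v u)) + b * ((g v - g u) * complex_of_real (w v u)))
        has_sum a * laplacian V w f v + b * laplacian V w g v) V"
      unfolding laplacian_def if_P[OF True]
      by (intro has_sum_add has_sum_cmult_right has_sum_infsum laplacian_summable f g True)
    moreover have "(\<lambda>u. a * ((f v - f u) * complex_of_real (w v u)) + b * ((g v - g u) * complex_of_real (w v u)))
        = (\<lambda>u. (a * f v + b * g v - (a * f u + b * g u)) * complex_of_real (w v u))"
      by (auto simp: algebra_simps)
    ultimately show ?thesis
      using True by (simp add: laplacian_def infsumI)
  qed (simp add: laplacian_def)
qed

lemma nonneg_selfadjoint_laplacian: "nonneg_selfadjoint_operator V (laplacian V w)"
  unfolding nonneg_selfadjoint_operator_def selfadjoint_operator_def bounded_operator_def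
proof (intro conjI ballI allI)
  fix f g assume f: "f \<in> L2 V" and g: "g \<in> L2 V"
  have "L2_inner V f (laplacian V w g) = cnj (L2_inner V (laplacian V w g) f)"
    unfolding L2_inner_def infsum_cnj[symmetric] by (rule infsum_cong) simp
  then show "L2_inner V (laplacian V w f) g = L2_inner V f (laplacian V w g)"
    by (simp add: L2_inner_laplacian f g dirichlet_form_cnj)
next
  fix f assume f: "f \<in> L2 V"
  show "0 \<le> Re (L2_inner V (laplacian V w f) f)"
    by (simp add: L2_inner_laplacian f dirichlet_form_self energy_nonneg)
next
  show "\<exists>C. \<forall>f\<in>L2 V. L2_norm V (laplacian V w f) \<le> C * L2_norm V f"
    using laplacian_in_L2(2) by blast
qed (simp_all add: laplacian_in_L2(1) laplacian_linear)

lemma inner_ell2_laplacian: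
  assumes x: "x \<in> L2_space V"
  shows "inner (ell2_operator V (laplacian V w) x) x = energy (ell2_apply x) / 2"
proof -
  have f: "ell2_apply x \<in> L2 V" using x by (simp add: L2_space_iff)
  have "inner (ell2_operator V (laplacian V w) x) x
      = Re (L2_inner V (laplacian V w (ell2_apply x)) (ell2_apply x))"
    unfolding Re_L2_inner[OF laplacian_in_L2(1)[OF f] f]
    by (simp add: ell2_operator_def ell2_restrict_id[OF x] ell2_apply_inverse)
  then show ?thesis by (simp add: L2_inner_laplacian f dirichlet_form_self)
qed

end

section \<open>Poincare inequalities\<close>

text \<open>Tychonoff's theorem in the function type. It provides the compact unit sphere for the
  Rayleigh quotient, taken in the product topology.\<close>

lemma compact_Pi_UNIV:
  fixes S :: "'v \<Rightarrow> 'b::topological_space set"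
  assumes "\<And>v. compact (S v)"
  shows "compact {g. \<forall>v. g v \<in> S v}"
proof -
  have "compactin (product_topology (\<lambda>v. euclidean) UNIV) (PiE UNIV S)"
    unfolding compactin_PiE using assms by auto
  then show ?thesis
    by (simp add: euclidean_product_topology PiE_UNIV_domain Pi_def)
qed

text \<open>For finite \<open>V\<close>, the orthogonal complement of the constants; on a connected
  graph these are the kernel of the Laplacian.\<close>

definition zero_sum_space :: "'v set \<Rightarrow> 'v ell2 set" where
  "zero_sum_space V = {x \<in> L2_space V. (\<Sum>v\<in>V. ell2_apply x v) = 0}"

lemma subspace_zero_sum_space: "subspace (zero_sum_space V)"
  using subspace_L2_space[of V]
  by (auto simp: subspace_def zero_sum_space_def sum.distrib simp flip: scaleR_sum_right)

lemma norm_ell2_power2_finite: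
  assumes V: "finite V" and x: "x \<in> L2_space V"
  shows "(norm x)\<^sup>2 = (\<Sum>v\<in>V. (cmod (ell2_apply x v))\<^sup>2)"
proof -
  have "(\<Sum>\<^sub>\<infinity>v. (cmod (ell2_apply x v))\<^sup>2) = (\<Sum>\<^sub>\<infinity>v\<in>V. (cmod (ell2_apply x v))\<^sup>2)"
    by (rule infsum_cong_neutral) (use x in \<open>auto simp: L2_space_def\<close>)
  then show ?thesis using V by (simp add: norm_ell2_power2)
qed

lemma finite_support_in_L2:
  assumes V: "finite V" and f: "\<And>v. v \<notin> V \<Longrightarrow> f v = 0"
  shows "f \<in> L2 V"
  using assms by (simp add: L2_def)

context bounded_graph
begin

lemma energy_scale: "energy (\<lambda>v. complex_of_real t * f v) = t\<^sup>2 * energy f"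
proof -
  have "energy (\<lambda>v. complex_of_real t * f v)
      = (\<Sum>\<^sub>\<infinity>x\<in>V \<times> V. t\<^sup>2 * (case x of (v, u) \<Rightarrow> (cmod (f v - f u))\<^sup>2 * w v u))"
    unfolding energy_def
  proof (rule infsum_cong, clarify)
    fix v u
    have "complex_of_real t * f v - complex_of_real t * f u = complex_of_real t * (f v - f u)"
      by (simp add: right_diff_distrib)
    then show "(cmod (complex_of_real t * f v - complex_of_real t * f u))\<^sup>2 * w v u
        = t\<^sup>2 * ((cmod (f v - f u))\<^sup>2 * w v u)"
      by (simp only: norm_mult norm_of_real power_mult_distrib power2_abs mult.assoc)
  qed
  then show ?thesis unfolding energy_def infsum_cmult_right' .
qed

lemma energy_finite:
  "finite V \<Longrightarrow> energy f = (\<Sum>(v, u)\<in>V \<times> V. (cmod (f v - f u))\<^sup>2 * w v u)"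
  by (simp add: energy_def)

lemma energy_eq_0_imp_constant:
  assumes V: "finite V" and conn: "graph_connected V w" and e: "energy f = 0"
    and uv: "u \<in> V" "v \<in> V"
  shows "f u = f v"
proof -
  have zero: "(cmod (f a - f b))\<^sup>2 * w a b = 0" if "a \<in> V" "b \<in> V" for a b
  proof -
    have "(\<Sum>(v, u)\<in>V \<times> V. (cmod (f v - f u))\<^sup>2 * w v u) = 0"
      using e V by (simp add: energy_finite)
    then have "\<forall>x\<in>V \<times> V. (case x of (v, u) \<Rightarrow> (cmod (f v - f u))\<^sup>2 * w v u) = 0"
      using V by (subst (asm) sum_nonneg_eq_0_iff) (auto simp: w_nonneg)
    then show ?thesis using that by auto
  qed
  have "(u, v) \<in> (edges V w)\<^sup>*" using conn uv by (simp add: graph_connected_def)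
  then show ?thesis
  proof (induction rule: rtrancl_induct)
    case (step a b)
    then show ?case using zero[of a b] by (simp add: edges_def)
  qed simp
qed

text \<open>Green's formula against the constant 1, whose differences vanish. It makes
  \<open>zero_sum_space V\<close> invariant and forces every eigenfunction of a nonzero eigenvalue
  into it.\<close>

lemma laplacian_zero_sum:
  assumes V: "finite V" and f: "f \<in> L2 V"
  shows "(\<Sum>v\<in>V. laplacian V w f v) = 0"
proof -
  let ?one = "\<lambda>v. if v \<in> V then 1 else 0 :: complex"
  have one: "?one \<in> L2 V" by (rule finite_support_in_L2[OF V]) simp
  have "dirichlet_form f ?one = 0"
    unfolding dirichlet_form_def by (rule infsum_0) auto
  then have "(\<Sum>\<^sub>\<infinity>v\<in>V. laplacian V w f v * cnj (?one v)) = 0"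
    using laplacian_dirichlet_form[OF f one] by simp
  then show ?thesis using V by simp
qed

text \<open>The unit sphere of the zero-sum functions is realized as a compact set \<open>K\<close>
  of functions, on which the energy, a finite sum of continuous terms, attains its minimum.
  Homogeneity extends the inequality from the sphere to all \<open>y\<close>.\<close>

lemma rayleigh_minimizer:
  assumes V: "finite V" "card V > 1"
  obtains x where "x \<in> zero_sum_space V" "norm x = 1"
    "\<And>y. y \<in> zero_sum_space V \<Longrightarrow> energy (ell2_apply x) * (norm y)\<^sup>2 \<le> energy (ell2_apply y)"
proof -
  define B where "B v = (if v \<in> V then cball 0 1 else {0 :: complex})" for v
  define K where "K = {g. \<forall>v. g v \<in> B v} \<inter> {g. (\<Sum>v\<in>V. g v) = 0} \<inter> {g. (\<Sum>v\<in>V. (cmod (g v))\<^sup>2) = 1}"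
  have coord: "continuous_on S (\<lambda>g. g v)" for S :: "('v \<Rightarrow> complex) set" and v
    by (rule continuous_on_subset[OF continuous_on_product_coordinates]) simp
  have "compact {g. \<forall>v. g v \<in> B v}"
    by (rule compact_Pi_UNIV) (simp add: B_def)
  moreover have "closed {g :: 'v \<Rightarrow> complex. (\<Sum>v\<in>V. g v) = 0}"
    by (intro closed_Collect_eq continuous_on_sum coord continuous_on_const)
  moreover have "closed {g :: 'v \<Rightarrow> complex. (\<Sum>v\<in>V. (cmod (g v))\<^sup>2) = 1}"
    by (intro closed_Collect_eq continuous_on_sum continuous_on_power continuous_on_norm
        coord continuous_on_const)
  ultimately have compK: "compact K"
    unfolding K_def by (intro compact_Int_closed)
  have K_iff: "ell2_apply x \<in> K \<longleftrightarrow> x \<in> zero_sum_space V \<and> norm x = 1" for x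
  proof
    assume "ell2_apply x \<in> K"
    then have x: "x \<in> zero_sum_space V" and n: "(\<Sum>v\<in>V. (cmod (ell2_apply x v))\<^sup>2) = 1"
      by (auto simp: K_def B_def zero_sum_space_def L2_space_def split: if_splits)
    then have "(norm x)\<^sup>2 = 1\<^sup>2"
      using norm_ell2_power2_finite[OF V(1), of x] by (simp add: zero_sum_space_def)
    then have "norm x = 1" by (rule power2_eq_imp_eq) simp_all
    then show "x \<in> zero_sum_space V \<and> norm x = 1" using x by simp
  next
    assume x: "x \<in> zero_sum_space V \<and> norm x = 1"
    then have "(\<Sum>v\<in>V. (cmod (ell2_apply x v))\<^sup>2) = 1"
      using norm_ell2_power2_finite[OF V(1), of x] by (simp add: zero_sum_space_def)
    then show "ell2_apply x \<in> K"
      using x norm_ell2_apply_le[of x] by (auto simp: K_def B_def zero_sum_space_def L2_space_def)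
  qed
  have of_K: "ell2_apply (ell2_of g) = g" if "g \<in> K" for g
  proof -
    have "g \<in> L2 V"
      by (rule finite_support_in_L2[OF V(1)]) (use that in \<open>auto simp: K_def B_def split: if_splits\<close>)
    then show ?thesis by (simp add: L2_square_summable)
  qed
  have normalize: "ell2_apply ((1 / norm y) *\<^sub>R y) \<in> K" if "y \<in> zero_sum_space V" "y \<noteq> 0" for y
    unfolding K_iff using that subspace_scale[OF subspace_zero_sum_space] by simp
  have "\<exists>y. y \<in> zero_sum_space V \<and> y \<noteq> 0"
  proof -
    obtain a b where ab: "a \<in> V" "b \<in> V" "a \<noteq> b"
      using card_le_Suc0_iff_eq[OF V(1)] V(2) by auto
    \<comment> \<open>The difference of two point masses: two vertices suffice for a nonzero
      zero-sum function, so the sphere is not empty.\<close>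
    let ?g = "\<lambda>v. if v = a then 1 else if v = b then -1 else 0 :: complex"
    have g: "?g \<in> L2 V" by (rule finite_support_in_L2[OF V(1)]) (use ab in auto)
    have "(\<Sum>v\<in>V. ?g v) = (\<Sum>v\<in>{a, b}. ?g v)"
      by (rule sum.mono_neutral_right) (use V ab in auto)
    then have "ell2_of ?g \<in> zero_sum_space V"
      using ab g by (simp add: zero_sum_space_def ell2_of_in_L2_space L2_square_summable)
    moreover have "ell2_of ?g \<noteq> 0"
    proof
      assume "ell2_of ?g = 0"
      then have "ell2_apply (ell2_of ?g) a = 0" by simp
      then show False using g by (simp add: L2_square_summable)
    qed
    ultimately show ?thesis by blast
  qed
  then have "K \<noteq> {}" using normalize by blast
  moreover have "continuous_on K energy"
    unfolding energy_finite[OF V(1)] case_prod_unfold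
    by (intro continuous_on_sum continuous_on_mult continuous_on_power continuous_on_norm
        continuous_on_diff coord continuous_on_const)
  ultimately obtain g where g: "g \<in> K" and min: "\<And>h. h \<in> K \<Longrightarrow> energy g \<le> energy h"
    using continuous_attains_inf[OF compK] by blast
  show thesis
  proof (rule that)
    show "ell2_of g \<in> zero_sum_space V" "norm (ell2_of g) = 1"
      using K_iff[of "ell2_of g"] g by (simp_all add: of_K)
    fix y assume y: "y \<in> zero_sum_space V"
    show "energy (ell2_apply (ell2_of g)) * (norm y)\<^sup>2 \<le> energy (ell2_apply y)"
    proof (cases "y = 0")
      case False
      have "ell2_apply ((1 / norm y) *\<^sub>R y) = (\<lambda>v. complex_of_real (1 / norm y) * ell2_apply y v)"
        by (simp add: fun_eq_iff scaleR_conv_of_real)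
      then have "energy g \<le> (1 / norm y)\<^sup>2 * energy (ell2_apply y)"
        using min[OF normalize[OF y False]] by (simp only: energy_scale)
      then show ?thesis using False by (simp add: of_K[OF g] field_simps)
    qed (simp add: energy_nonneg)
  qed
qed

text \<open>Minimality says that the form of \<open>?B\<close>, the Laplacian minus
  \<open>?\<mu>\<close>, is non-negative on the zero-sum space and vanishes at \<open>x\<close>. For
  such a form \<open>norm_power2_le_quadratic_form\<close> bounds \<open>norm (?B x)\<close> by the
  vanishing value. The factor \<open>2 * c\<close> is half of the energy bound.\<close>

lemma rayleigh_minimizer_eigenvector:
  assumes V: "finite V"
    and x: "x \<in> zero_sum_space V" "norm x = 1"
    and min: "\<And>y. y \<in> zero_sum_space V \<Longrightarrow> energy (ell2_apply x) * (norm y)\<^sup>2 \<le> energy (ell2_apply y)"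
  shows "ell2_operator V (laplacian V w) x = (energy (ell2_apply x) / 2) *\<^sub>R x"
proof -
  let ?L = "ell2_operator V (laplacian V w)" and ?\<mu> = "energy (ell2_apply x) / 2"
  let ?B = "\<lambda>y. ?L y - ?\<mu> *\<^sub>R y"
  have sL: "selfadjoint ?L" and bL: "bounded_operator V (laplacian V w)"
    using nonneg_selfadjoint_laplacian selfadjoint_ell2_operator
    by (auto simp: nonneg_selfadjoint_operator_def selfadjoint_operator_def)
  have linL: "linear ?L" using sL by (rule selfadjoint_linear)
  have L2: "y \<in> L2_space V" if "y \<in> zero_sum_space V" for y
    using that by (simp add: zero_sum_space_def)
  have Lz: "?L y \<in> zero_sum_space V" if "y \<in> zero_sum_space V" for y
    using laplacian_zero_sum[OF V, of "ell2_apply y"] L2[OF that]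
    by (simp add: zero_sum_space_def ell2_operator_in_L2_space[OF bL] ell2_apply_operator[OF bL]
        L2_space_iff laplacian_in_L2(1))
  have inner_B: "inner (?B y) y = energy (ell2_apply y) / 2 - ?\<mu> * (norm y)\<^sup>2"
    if "y \<in> zero_sum_space V" for y
    by (simp add: inner_diff_left inner_ell2_laplacian[OF L2[OF that]] power2_norm_eq_inner)
  have "(norm (?B x))\<^sup>2 \<le> (2 * c) * inner (?B x) x"
  proof (rule norm_power2_le_quadratic_form[where S = "zero_sum_space V" and T = ?B])
    show "linear ?B"
      by (intro linear_compose_sub linL linear_scale_self)
    show "subspace (zero_sum_space V)" by (rule subspace_zero_sum_space)
    show "?B y \<in> zero_sum_space V" if "y \<in> zero_sum_space V" for y
      by (intro subspace_diff subspace_scale subspace_zero_sum_space Lz that)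
    show "inner (?B y) z = inner y (?B z)" for y z
      using sL by (simp add: selfadjoint_def inner_diff_left inner_diff_right)
    fix y assume y: "y \<in> zero_sum_space V"
    show "0 \<le> inner (?B y) y" using min[OF y] by (simp add: inner_B[OF y])
    have "energy (ell2_apply y) \<le> 4 * c * (norm y)\<^sup>2"
      using energy_bound(2)[of "ell2_apply y"] L2[OF y]
      by (simp add: L2_space_iff ell2_apply_inverse)
    moreover have "0 \<le> ?\<mu> * (norm y)\<^sup>2" using energy_nonneg[of "ell2_apply x"] by simp
    ultimately show "inner (?B y) y \<le> 2 * c * (norm y)\<^sup>2" by (simp add: inner_B[OF y])
  qed (use c_pos x in auto)
  also have "inner (?B x) x = 0" using inner_B[OF x(1)] x(2) by simp
  finally show ?thesis by simp
qed

text \<open>A \<open>LEAST\<close> over the reals is meaningful only if attained. The minimal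
  Rayleigh quotient is an eigenvalue, nonzero because zero energy on a connected graph means
  constant; any other nonzero eigenvalue has a zero-sum eigenfunction and is therefore at least as
  large.\<close>

lemma first_nonzero_eigenvalue_variational:
  assumes V: "finite V" "card V > 1" and conn: "graph_connected V w"
  shows "0 < first_nonzero_eigenvalue V w"
    and "\<And>y. y \<in> zero_sum_space V \<Longrightarrow>
      first_nonzero_eigenvalue V w * (norm y)\<^sup>2 \<le> energy (ell2_apply y) / 2"
proof -
  obtain x where x: "x \<in> zero_sum_space V" "norm x = 1"
    and min: "\<And>y. y \<in> zero_sum_space V \<Longrightarrow> energy (ell2_apply x) * (norm y)\<^sup>2 \<le> energy (ell2_apply y)"
    using rayleigh_minimizer[OF V] by metis
  let ?\<mu> = "energy (ell2_apply x) / 2"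
  have bL: "bounded_operator V (laplacian V w)"
    using nonneg_selfadjoint_laplacian
    by (auto simp: nonneg_selfadjoint_operator_def selfadjoint_operator_def)
  have xL2: "x \<in> L2_space V" using x by (simp add: zero_sum_space_def)
  have x0: "\<exists>v\<in>V. ell2_apply x v \<noteq> 0"
  proof (rule ccontr)
    assume "\<not> ?thesis"
    then have "x = 0" using xL2 by (intro ell2_eqI) (auto simp: L2_space_def)
    then show False using x by simp
  qed
  have "?\<mu> \<noteq> 0"
  proof
    assume "?\<mu> = 0"
    then have e: "energy (ell2_apply x) = 0" by simp
    obtain v where v: "v \<in> V" "ell2_apply x v \<noteq> 0" using x0 by blast
    have "(\<Sum>u\<in>V. ell2_apply x u) = (\<Sum>u\<in>V. ell2_apply x v)"
      by (intro sum.cong refl energy_eq_0_imp_constant[OF V(1) conn e] v(1))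
    then show False using x v V by (simp add: zero_sum_space_def)
  qed
  then have pos: "?\<mu> > 0" using energy_nonneg[of "ell2_apply x"] by simp
  have eig: "laplacian V w (ell2_apply x) = (\<lambda>v. complex_of_real ?\<mu> * ell2_apply x v)"
    using arg_cong[OF rayleigh_minimizer_eigenvector[OF V(1) x min], of ell2_apply]
    unfolding ell2_apply_operator[OF bL xL2] by (simp add: fun_eq_iff scaleR_conv_of_real)
  have "laplacian_eigenvalue V w ?\<mu>"
    unfolding laplacian_eigenvalue_def
    by (intro bexI[of _ "ell2_apply x"] conjI eig) (use x0 xL2 in \<open>auto simp: L2_space_iff\<close>)
  moreover have "?\<mu> \<le> \<nu>" if \<nu>: "laplacian_eigenvalue V w \<nu>" "\<nu> \<noteq> 0" for \<nu>
  proof -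
    obtain f where f: "f \<in> L2 V" "f \<noteq> (\<lambda>v. 0)"
      and ev: "laplacian V w f = (\<lambda>v. complex_of_real \<nu> * f v)"
      using \<nu>(1) by (auto simp: laplacian_eigenvalue_def)
    have "complex_of_real \<nu> * (\<Sum>v\<in>V. f v) = 0"
      using laplacian_zero_sum[OF V(1) f(1)] unfolding ev by (simp add: sum_distrib_left)
    then have "(\<Sum>v\<in>V. f v) = 0" using \<nu>(2) by simp
    then have y: "ell2_of f \<in> zero_sum_space V"
      using f by (simp add: zero_sum_space_def ell2_of_in_L2_space L2_square_summable)
    have y0: "ell2_of f \<noteq> 0"
    proof
      assume "ell2_of f = 0"
      then have "ell2_apply (ell2_of f) v = 0" for v by simp
      then show False using f by (auto simp: L2_square_summable)
    qed
    have "ell2_operator V (laplacian V w) (ell2_of f) = \<nu> *\<^sub>R ell2_of f"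
      unfolding ell2_operator_of[OF bL f(1)] ev
      using f by (intro ell2_eqI) (simp add: L2_square_summable square_summable_mult scaleR_conv_of_real)
    then have "energy f / 2 = \<nu> * (norm (ell2_of f))\<^sup>2"
      using inner_ell2_laplacian[OF ell2_of_in_L2_space[OF f(1)]] f
      by (simp add: L2_square_summable power2_norm_eq_inner)
    then have "?\<mu> * (norm (ell2_of f))\<^sup>2 \<le> \<nu> * (norm (ell2_of f))\<^sup>2"
      using min[OF y] f by (simp add: L2_square_summable)
    then show ?thesis using y0 by simp
  qed
  ultimately have eq: "first_nonzero_eigenvalue V w = ?\<mu>"
    unfolding first_nonzero_eigenvalue_def using \<open>?\<mu> \<noteq> 0\<close> by (intro Least_equality) auto
  show "0 < first_nonzero_eigenvalue V w" unfolding eq by (rule pos)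
  show "first_nonzero_eigenvalue V w * (norm y)\<^sup>2 \<le> energy (ell2_apply y) / 2"
    if "y \<in> zero_sum_space V" for y
    unfolding eq using min[OF that] by simp
qed

end

lemma poincare_finite_graph:
  assumes w: "weighted_graph \<Omega> w" and \<Omega>: "finite \<Omega>" "card \<Omega> > 1" and conn: "graph_connected \<Omega> w"
  shows "0 < first_nonzero_eigenvalue \<Omega> w"
    and "(\<Sum>v\<in>\<Omega>. f v) = 0 \<Longrightarrow> first_nonzero_eigenvalue \<Omega> w * (\<Sum>v\<in>\<Omega>. (cmod (f v))\<^sup>2)
      \<le> (\<Sum>(v, u)\<in>\<Omega> \<times> \<Omega>. (cmod (f v - f u))\<^sup>2 * w v u) / 2"
proof -
  obtain c where "bounded_graph \<Omega> w c"
    using bounded_graphI[OF w finite_imp_bounded_degrees[OF \<Omega>(1)]] .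
  then interpret bounded_graph \<Omega> w c .
  show "0 < first_nonzero_eigenvalue \<Omega> w"
    by (rule first_nonzero_eigenvalue_variational(1)[OF \<Omega> conn])
  assume sum0: "(\<Sum>v\<in>\<Omega>. f v) = 0"
  let ?g = "\<lambda>v. if v \<in> \<Omega> then f v else 0"
  have g: "?g \<in> L2 \<Omega>" by (rule finite_support_in_L2[OF \<Omega>(1)]) simp
  have "ell2_of ?g \<in> zero_sum_space \<Omega>"
    using sum0 g by (simp add: zero_sum_space_def ell2_of_in_L2_space L2_square_summable)
  from first_nonzero_eigenvalue_variational(2)[OF \<Omega> conn this]
  have "first_nonzero_eigenvalue \<Omega> w * (\<Sum>v\<in>\<Omega>. (cmod (?g v))\<^sup>2) \<le> energy ?g / 2"
    using g by (simp only: norm_ell2_power2_finite[OF \<Omega>(1) ell2_of_in_L2_space[OF g]]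
        ell2_apply_ell2_of[OF L2_square_summable[OF g]])
  moreover have "energy ?g = (\<Sum>(v, u)\<in>\<Omega> \<times> \<Omega>. (cmod (f v - f u))\<^sup>2 * w v u)"
    unfolding energy_finite[OF \<Omega>(1)] by (rule sum.cong) auto
  ultimately show "first_nonzero_eigenvalue \<Omega> w * (\<Sum>v\<in>\<Omega>. (cmod (f v))\<^sup>2)
      \<le> (\<Sum>(v, u)\<in>\<Omega> \<times> \<Omega>. (cmod (f v - f u))\<^sup>2 * w v u) / 2"
    by simp
qed

text \<open>The squares \<open>\<Omega> \<times> \<Omega>\<close> of distinct blocks are disjoint in
  \<open>V \<times> V\<close>, so the local inequalities add up; edges between blocks only increase
  the energy. The sum runs over the finitely many blocks meeting a finite \<open>F\<close>, with a
  bound independent of \<open>F\<close>.\<close>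

lemma (in bounded_graph) poincare_partition:
  assumes w: "weighted_graph V w" and part: "partition_on V \<Xi>"
    and parts: "\<And>\<Omega>. \<Omega> \<in> \<Xi> \<Longrightarrow> finite \<Omega> \<and> card \<Omega> > 1 \<and> graph_connected \<Omega> w"
    and \<Lambda>: "\<Lambda> > 0" "\<And>\<Omega>. \<Omega> \<in> \<Xi> \<Longrightarrow> \<Lambda> \<le> first_nonzero_eigenvalue \<Omega> w"
    and f: "f \<in> L2 V" and sum0: "\<And>\<Omega>. \<Omega> \<in> \<Xi> \<Longrightarrow> (\<Sum>v\<in>\<Omega>. f v) = 0"
  shows "\<Lambda> * (norm (ell2_of f))\<^sup>2 \<le> energy f / 2"
proof -
  have sub: "\<Omega> \<subseteq> V" if "\<Omega> \<in> \<Xi>" for \<Omega> using part that by (auto simp: partition_on_def)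
  have local_bound: "\<Lambda> * (\<Sum>v\<in>\<Omega>. (cmod (f v))\<^sup>2)
      \<le> (\<Sum>(v, u)\<in>\<Omega> \<times> \<Omega>. (cmod (f v - f u))\<^sup>2 * w v u) / 2" if "\<Omega> \<in> \<Xi>" for \<Omega>
  proof -
    have "weighted_graph \<Omega> w" using w sub[OF that] by (auto simp: weighted_graph_def)
    then have "first_nonzero_eigenvalue \<Omega> w * (\<Sum>v\<in>\<Omega>. (cmod (f v))\<^sup>2)
        \<le> (\<Sum>(v, u)\<in>\<Omega> \<times> \<Omega>. (cmod (f v - f u))\<^sup>2 * w v u) / 2"
      using poincare_finite_graph(2) parts[OF that] sum0[OF that] by blast
    moreover have "\<Lambda> * (\<Sum>v\<in>\<Omega>. (cmod (f v))\<^sup>2) \<le> first_nonzero_eigenvalue \<Omega> w * (\<Sum>v\<in>\<Omega>. (cmod (f v))\<^sup>2)"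
      by (intro mult_right_mono \<Lambda>(2) that sum_nonneg) simp
    ultimately show ?thesis by linarith
  qed
  have "(\<Sum>v\<in>F. (cmod (f v))\<^sup>2) \<le> energy f / (2 * \<Lambda>)" if F: "finite F" for F
  proof -
    have "\<forall>v\<in>F \<inter> V. \<exists>\<Omega>\<in>\<Xi>. v \<in> \<Omega>" using part by (auto simp: partition_on_def)
    then obtain p where p: "\<And>v. v \<in> F \<inter> V \<Longrightarrow> p v \<in> \<Xi> \<and> v \<in> p v" by metis
    let ?G = "p ` (F \<inter> V)"
    have G: "finite ?G" "?G \<subseteq> \<Xi>" using F p by auto
    have finG: "\<forall>\<Omega>\<in>?G. finite \<Omega>" "\<forall>\<Omega>\<in>?G. finite (\<Omega> \<times> \<Omega>)" using G parts by blast+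
    have disj: "\<forall>\<Omega>\<in>?G. \<forall>\<Omega>'\<in>?G. \<Omega> \<noteq> \<Omega>' \<longrightarrow> \<Omega> \<inter> \<Omega>' = {}"
      using partition_onD2[OF part] G(2) unfolding disjoint_def by (meson subsetD)
    then have disj2: "\<forall>\<Omega>\<in>?G. \<forall>\<Omega>'\<in>?G. \<Omega> \<noteq> \<Omega>' \<longrightarrow> (\<Omega> \<times> \<Omega>) \<inter> (\<Omega>' \<times> \<Omega>') = {}"
      by blast
    have "(\<Sum>v\<in>F. (cmod (f v))\<^sup>2) = (\<Sum>v\<in>F \<inter> V. (cmod (f v))\<^sup>2)"
      by (rule sum.mono_neutral_right) (use F f in \<open>auto simp: L2_iff\<close>)
    also have "\<dots> \<le> (\<Sum>v\<in>(\<Union>\<Omega>\<in>?G. \<Omega>). (cmod (f v))\<^sup>2)"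
      by (rule sum_mono2) (use G finG p in auto)
    also have "\<dots> = (\<Sum>\<Omega>\<in>?G. \<Sum>v\<in>\<Omega>. (cmod (f v))\<^sup>2)"
      by (rule sum.UNION_disjoint[OF G(1) finG(1) disj])
    also have "\<Lambda> * \<dots> \<le> (\<Sum>\<Omega>\<in>?G. (\<Sum>(v, u)\<in>\<Omega> \<times> \<Omega>. (cmod (f v - f u))\<^sup>2 * w v u) / 2)"
      by (subst sum_distrib_left, rule sum_mono, rule local_bound) (use G(2) in blast)
    also have "\<dots> = (\<Sum>(v, u)\<in>(\<Union>\<Omega>\<in>?G. \<Omega> \<times> \<Omega>). (cmod (f v - f u))\<^sup>2 * w v u) / 2"
      unfolding sum.UNION_disjoint[OF G(1) finG(2) disj2] sum_divide_distrib by simp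
    also have "\<dots> \<le> energy f / 2"
    proof -
      have "(\<Sum>(v, u)\<in>(\<Union>\<Omega>\<in>?G. \<Omega> \<times> \<Omega>). (cmod (f v - f u))\<^sup>2 * w v u) \<le> energy f"
        unfolding energy_def
      proof (rule finite_sum_le_infsum[OF energy_bound(1)[OF f]])
        show "(\<Union>\<Omega>\<in>?G. \<Omega> \<times> \<Omega>) \<subseteq> V \<times> V" using G(2) sub by blast
      qed (use F G finG sub in \<open>auto intro!: mult_nonneg_nonneg w_nonneg\<close>)
      then show ?thesis by simp
    qed
    finally show ?thesis using \<Lambda> by (simp add: field_simps)
  qed
  from square_summable_norm_leI(2)[OF this] show ?thesis
    using \<Lambda> by (simp add: field_simps)
qed

section \<open>Paley-Wiener spaces\<close>

lemma bounded_operator_projection: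
  assumes "projection_valued_measure V E" "A \<in> sets borel"
  shows "bounded_operator V (E A)" "selfadjoint_operator V (E A)"
  using assms by (auto simp: projection_valued_measure_def orthogonal_projection_def selfadjoint_operator_def)

lemma ell2_projection_inter:
  assumes E: "projection_valued_measure V E" and A: "A \<in> sets borel" and B: "B \<in> sets borel"
  shows "ell2_operator V (E A) (ell2_operator V (E B) x) = ell2_operator V (E (A \<inter> B)) x"
proof -
  let ?f = "ell2_apply (ell2_restrict V x)"
  have f: "?f \<in> L2 V" by (simp flip: L2_space_iff)
  have "E (A \<inter> B) ?f = E A (E B ?f)"
    using E A B f by (simp add: projection_valued_measure_def)
  then show ?thesis
    using ell2_operator_of[OF bounded_operator_projection(1)[OF E A]
        bounded_operator_in_L2[OF bounded_operator_projection(1)[OF E B] f]]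
    by (simp add: ell2_operator_def)
qed

lemma ell2_projection_UNIV:
  assumes E: "projection_valued_measure V E" and x: "x \<in> L2_space V"
  shows "ell2_operator V (E UNIV) x = x"
  using E x by (simp add: projection_valued_measure_def ell2_operator_def ell2_restrict_id
      L2_space_iff ell2_apply_inverse)

lemma sets_scalar_measure [simp]: "sets (scalar_measure V E f) = sets borel"
  using sets.sigma_sets_eq[of "borel :: real measure"]
  by (simp add: scalar_measure_def sets_measure_of_conv)

lemma space_scalar_measure [simp]: "space (scalar_measure V E f) = UNIV"
  by (simp add: scalar_measure_def space_measure_of_conv)

lemma emeasure_scalar_measure:
  assumes E: "projection_valued_measure V E" and x: "x \<in> L2_space V" and A: "A \<in> sets borel"
  shows "emeasure (scalar_measure V E (ell2_apply x)) A = ennreal (inner (ell2_operator V (E A) x) x)"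
proof -
  have f: "ell2_apply x \<in> L2 V" using x by (simp add: L2_space_iff)
  have EA: "E A (ell2_apply x) \<in> L2 V"
    by (rule bounded_operator_in_L2[OF bounded_operator_projection(1)[OF E A] f])
  have ms: "measure_space UNIV (sets borel) (\<lambda>B. ennreal (Re (L2_inner V (E B (ell2_apply x)) (ell2_apply x))))"
    using E f by (simp add: projection_valued_measure_def)
  have sig: "sigma_sets UNIV (sets (borel :: real measure)) = sets borel"
    using sets.sigma_sets_eq[of "borel :: real measure"] by simp
  have "emeasure (scalar_measure V E (ell2_apply x)) A
      = ennreal (Re (L2_inner V (E A (ell2_apply x)) (ell2_apply x)))"
    unfolding scalar_measure_def emeasure_measure_of_conv sig using ms A by simp
  also have "Re (L2_inner V (E A (ell2_apply x)) (ell2_apply x)) = inner (ell2_operator V (E A) x) x"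
    unfolding Re_L2_inner[OF EA f] by (simp add: ell2_operator_def ell2_restrict_id[OF x] ell2_apply_inverse)
  finally show ?thesis .
qed

lemma inner_ell2_projection:
  assumes E: "projection_valued_measure V E" and A: "A \<in> sets borel"
  shows "inner (ell2_operator V (E A) x) x = (norm (ell2_operator V (E A) x))\<^sup>2"
  using ell2_projection_inter[OF E A A, of x]
    selfadjoint_ell2_operator[OF bounded_operator_projection(2)[OF E A]]
  by (simp add: selfadjoint_def power2_norm_eq_inner)

text \<open>Projecting onto the range of \<open>E B\<close>, or onto its complement, cuts the
  spectral measure down to \<open>B\<close>, or to \<open>- B\<close>. The first is multiplicativity
  of \<open>E\<close>. In the second, all mixed terms equal the value at
  \<open>A \<inter> B\<close>, and the remaining difference is the value at
  \<open>A \<inter> - B\<close>.\<close>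

lemma scalar_measure_projection:
  assumes E: "projection_valued_measure V E" and x: "x \<in> L2_space V" and B: "B \<in> sets borel"
  defines "M \<equiv> scalar_measure V E (ell2_apply x)"
  shows "scalar_measure V E (ell2_apply (ell2_operator V (E B) x)) = density M (indicator B)"
    and "scalar_measure V E (ell2_apply (x - ell2_operator V (E B) x)) = density M (indicator (- B))"
proof -
  let ?P = "\<lambda>A. ell2_operator V (E A)"
  have sets_M: "sets M = sets borel" by (simp add: M_def)
  have sa: "inner (?P A y) z = inner y (?P A z)" if "A \<in> sets borel" for A y z
    using selfadjoint_ell2_operator[OF bounded_operator_projection(2)[OF E that]]
    by (simp add: selfadjoint_def)
  have lin: "linear (?P A)" if "A \<in> sets borel" for A
    by (rule selfadjoint_linear[OF selfadjoint_ell2_operator[OF bounded_operator_projection(2)[OF E that]]])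
  have inL2: "?P B x \<in> L2_space V"
    by (rule ell2_operator_in_L2_space[OF bounded_operator_projection(1)[OF E B]])
  have PxL2: "x - ?P B x \<in> L2_space V"
    by (rule subspace_diff[OF subspace_L2_space x inL2])
  have inner_P: "inner (?P A (?P B x)) (?P B x) = inner (?P (A \<inter> B) x) x" if A: "A \<in> sets borel" for A
    using A B by (simp add: ell2_projection_inter[OF E] flip: sa[OF B]) (simp add: Int_left_commute Int_commute)
  show "scalar_measure V E (ell2_apply (?P B x)) = density M (indicator B)"
  proof (rule measure_eqI)
    fix A assume "A \<in> sets (scalar_measure V E (ell2_apply (?P B x)))"
    then have A: "A \<in> sets borel" by simp
    have "emeasure (density M (indicator B)) A = emeasure M (A \<inter> B)"
      using A B by (simp add: emeasure_restricted sets_M Int_commute)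
    then show "emeasure (scalar_measure V E (ell2_apply (?P B x))) A = emeasure (density M (indicator B)) A"
      using A B by (simp add: emeasure_scalar_measure[OF E] x inL2 inner_P M_def)
  qed (simp add: sets_M)
  show "scalar_measure V E (ell2_apply (x - ?P B x)) = density M (indicator (- B))"
  proof (rule measure_eqI)
    fix A assume "A \<in> sets (scalar_measure V E (ell2_apply (x - ?P B x)))"
    then have A: "A \<in> sets borel" by simp
    have AB: "A \<inter> B \<in> sets borel" "A \<inter> - B \<in> sets borel" using A B by auto
    have "inner (?P A (x - ?P B x)) (x - ?P B x)
        = inner (?P A x) x - inner (?P A x) (?P B x) - inner (?P A (?P B x)) x
          + inner (?P A (?P B x)) (?P B x)"
      by (simp add: linear_diff[OF lin[OF A]] inner_diff_left inner_diff_right)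
    also have "inner (?P A x) (?P B x) = inner (?P (A \<inter> B) x) x"
      using A B by (simp add: ell2_projection_inter[OF E] Int_commute flip: sa[OF B])
    also have "inner (?P A (?P B x)) x = inner (?P (A \<inter> B) x) x"
      using A B by (simp add: ell2_projection_inter[OF E])
    finally have diff: "inner (?P A (x - ?P B x)) (x - ?P B x) = inner (?P A x) x - inner (?P (A \<inter> B) x) x"
      using inner_P[OF A] by simp
    \<comment> \<open>Additivity of \<open>E\<close> is assumed through its scalar measures, so it
      is taken there and carried back to real numbers, where the non-negative values can be
      compared.\<close>
    have "emeasure M A = emeasure M (A \<inter> B) + emeasure M (A \<inter> - B)"
      using AB by (subst plus_emeasure) (auto simp: sets_M intro: arg_cong[where f = "emeasure M"])
    then have "ennreal (inner (?P A x) x)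
        = ennreal (inner (?P (A \<inter> B) x) x + inner (?P (A \<inter> - B) x) x)"
      using A AB by (simp add: M_def emeasure_scalar_measure[OF E x] inner_ell2_projection[OF E] ennreal_plus)
    then have "inner (?P A x) x = inner (?P (A \<inter> B) x) x + inner (?P (A \<inter> - B) x) x"
      using A AB by (subst (asm) ennreal_inj) (simp_all add: inner_ell2_projection[OF E])
    then have eq: "inner (?P A (x - ?P B x)) (x - ?P B x) = inner (?P (A \<inter> - B) x) x"
      using diff by simp
    have "emeasure (density M (indicator (- B))) A = emeasure M (A \<inter> - B)"
      using A B by (simp add: emeasure_restricted sets_M Int_commute)
    then show "emeasure (scalar_measure V E (ell2_apply (x - ?P B x))) A
        = emeasure (density M (indicator (- B))) A"
      using A AB by (simp add: emeasure_scalar_measure[OF E] x PxL2 eq M_def)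
  qed (simp add: sets_M)
qed

section \<open>The operator on its spectral subspaces\<close>

locale spectral_operator =
  fixes V :: "'v set" and T :: "('v \<Rightarrow> complex) \<Rightarrow> 'v \<Rightarrow> complex" and E
  assumes T: "nonneg_selfadjoint_operator V T" and E: "spectral_measure V T E"
begin

abbreviation op :: "'v ell2 \<Rightarrow> 'v ell2" where "op \<equiv> ell2_operator V T"
abbreviation proj :: "real set \<Rightarrow> 'v ell2 \<Rightarrow> 'v ell2" where "proj B \<equiv> ell2_operator V (E B)"
abbreviation meas :: "'v ell2 \<Rightarrow> real measure" where
  "meas x \<equiv> scalar_measure V E (ell2_apply x)"

lemma pvm: "projection_valued_measure V E"
  using E by (simp add: spectral_measure_def)

lemma bounded_T: "bounded_operator V T"
  using T by (simp add: nonneg_selfadjoint_operator_def selfadjoint_operator_def)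

lemma selfadjoint_op: "inner (op x) y = inner x (op y)"
  using nonneg_selfadjoint_ell2_operator[OF T] by (simp add: nonneg_selfadjoint_def selfadjoint_def)

lemma linear_op: "linear op"
  by (rule bounded_linear.linear[OF bounded_linear_ell2_operator[OF bounded_T]])

lemma linear_proj: "B \<in> sets borel \<Longrightarrow> linear (proj B)"
  by (rule bounded_linear.linear[OF bounded_linear_ell2_operator[OF bounded_operator_projection(1)[OF pvm]]])

lemma selfadjoint_proj: "B \<in> sets borel \<Longrightarrow> inner (proj B x) y = inner x (proj B y)"
  using selfadjoint_ell2_operator[OF bounded_operator_projection(2)[OF pvm]] by (simp add: selfadjoint_def)

lemma proj_idem: "B \<in> sets borel \<Longrightarrow> proj B (proj B x) = proj B x"
  using ell2_projection_inter[OF pvm] by simp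

lemma proj_in_L2_space: "B \<in> sets borel \<Longrightarrow> proj B x \<in> L2_space V"
  by (rule ell2_operator_in_L2_space[OF bounded_operator_projection(1)[OF pvm]])

lemma op_in_L2_space: "op x \<in> L2_space V"
  by (rule ell2_operator_in_L2_space[OF bounded_T])

lemma quadratic_form_integral:
  assumes x: "x \<in> L2_space V"
  shows "integrable (meas x) (\<lambda>t. t)" and "inner (op x) x = (\<integral>t. t \<partial>meas x)"
proof -
  have f: "ell2_apply x \<in> L2 V" using x by (simp add: L2_space_iff)
  show "integrable (meas x) (\<lambda>t. t)" using E f by (simp add: spectral_measure_def)
  have "L2_inner V (T (ell2_apply x)) (ell2_apply x) = complex_of_real (\<integral>t. t \<partial>meas x)"
    using E f by (simp add: spectral_measure_def)
  then have "Re (L2_inner V (T (ell2_apply x)) (ell2_apply x)) = (\<integral>t. t \<partial>meas x)" by simp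
  then show "inner (op x) x = (\<integral>t. t \<partial>meas x)"
    unfolding Re_L2_inner[OF bounded_operator_in_L2[OF bounded_T f] f]
    by (simp add: ell2_operator_def ell2_restrict_id[OF x] ell2_apply_inverse)
qed

lemma integral_density_indicator:
  assumes x: "x \<in> L2_space V" and B: "B \<in> sets borel"
  shows "(\<integral>t. t \<partial>density (meas x) (indicator B)) = (\<integral>t. indicator B t * t \<partial>meas x)"
proof -
  have "(\<integral>t. t \<partial>density (meas x) (\<lambda>t. ennreal (indicator B t))) = (\<integral>t. indicator B t *\<^sub>R t \<partial>meas x)"
  proof (rule integral_density)
    show "(\<lambda>t. t) \<in> borel_measurable (meas x)"
      by (rule borel_measurable_integrable[OF quadratic_form_integral(1)[OF x]])
    show "indicator B \<in> borel_measurable (meas x)"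
      by (rule borel_measurable_indicator) (simp add: B)
  qed simp
  then show ?thesis by (simp add: ennreal_indicator)
qed

lemma integrable_indicator_times:
  assumes x: "x \<in> L2_space V" and B: "B \<in> sets borel"
  shows "integrable (meas x) (\<lambda>t. indicator B t * t)"
  using integrable_mult_indicator[of B "meas x" "\<lambda>t. t"] quadratic_form_integral(1)[OF x] B by simp

text \<open>The integral of t splits over \<open>B\<close> and \<open>- B\<close>, and the two parts
  are the integrals for the two components of \<open>x\<close>. Since \<open>E\<close> represents
  \<open>T\<close> through diagonal values, this is how commutation of \<open>T\<close> with
  \<open>E B\<close> first becomes visible.\<close>

lemma quadratic_form_split:
  assumes x: "x \<in> L2_space V" and B: "B \<in> sets borel"
  shows "inner (op x) x
    = inner (op (proj B x)) (proj B x) + inner (op (x - proj B x)) (x - proj B x)"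
proof -
  have B': "- B \<in> sets borel" using B by auto
  have xL2: "proj B x \<in> L2_space V" "x - proj B x \<in> L2_space V"
    using proj_in_L2_space[OF B] subspace_diff[OF subspace_L2_space x] by auto
  have "inner (op (proj B x)) (proj B x) + inner (op (x - proj B x)) (x - proj B x)
      = (\<integral>t. indicator B t * t \<partial>meas x) + (\<integral>t. indicator (- B) t * t \<partial>meas x)"
    unfolding quadratic_form_integral(2)[OF xL2(1)] quadratic_form_integral(2)[OF xL2(2)]
      scalar_measure_projection[OF pvm x B]
      integral_density_indicator[OF x B] integral_density_indicator[OF x B'] ..
  also have "\<dots> = (\<integral>t. indicator B t * t + indicator (- B) t * t \<partial>meas x)"
    by (rule Bochner_Integration.integral_add[symmetric])
       (rule integrable_indicator_times[OF x B], rule integrable_indicator_times[OF x B'])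
  also have "\<dots> = (\<integral>t. t \<partial>meas x)"
    by (rule Bochner_Integration.integral_cong) (auto split: split_indicator)
  finally show ?thesis unfolding quadratic_form_integral(2)[OF x] by simp
qed

text \<open>
  By the previous lemma the cross terms \<open>\<langle>T p, q\<rangle>\<close> with \<open>p\<close> in the range of the projection and
  \<open>q\<close> orthogonal to it vanish, so the range is invariant under \<open>T\<close>.
\<close>

lemma proj_op_invariant:
  assumes B: "B \<in> sets borel" and x: "proj B x = x"
  shows "proj B (op x) = op x"
proof -
  have xL2: "x \<in> L2_space V" using proj_in_L2_space[OF B, of x] x by simp
  let ?q = "op x - proj B (op x)"
  have Pq: "proj B ?q = 0" by (simp add: linear_diff[OF linear_proj[OF B]] proj_idem[OF B])
  have qL2: "?q \<in> L2_space V"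
    by (rule subspace_diff[OF subspace_L2_space op_in_L2_space proj_in_L2_space[OF B]])
  have Pxq: "proj B (x + ?q) = x"
    using Pq x by (simp only: linear_add[OF linear_proj[OF B]]) simp
  have "inner (op (x + ?q)) (x + ?q) = inner (op x) x + inner (op ?q) ?q"
    using quadratic_form_split[OF subspace_add[OF subspace_L2_space xL2 qL2] B]
    unfolding Pxq by simp
  then have "inner (op x) ?q + inner (op ?q) x = 0"
    by (simp only: linear_add[OF linear_op] inner_add_left inner_add_right)
  \<comment> \<open>The real inner product is symmetric, so the two cross terms are equal, and their
    vanishing sum annihilates each.\<close>
  moreover have "inner (op ?q) x = inner (op x) ?q"
    using selfadjoint_op[of ?q x] by (simp only: inner_commute)
  ultimately have "inner (op x) ?q = 0" by simp
  moreover have "inner (proj B (op x)) ?q = 0"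
    using selfadjoint_proj[OF B, of "op x" ?q] Pq by simp
  ultimately have "inner ?q ?q = 0" by (simp only: inner_diff_left[of "op x"])
  then show ?thesis by simp
qed

text \<open>For a vector in the spectral subspace the scalar measure lives on
  \<open>{0..\<omega>}\<close> and has total mass \<open>(norm y)^2\<close>, so the form is at most
  \<omega>. Invariance of the subspace turns the form bound into a norm bound.\<close>

lemma norm_op_le:
  assumes \<omega>: "\<omega> > 0" and x: "proj {0..\<omega>} x = x"
  shows "norm (op x) \<le> \<omega> * norm x"
proof (rule norm_le_of_quadratic_form_le[where S = "{x. proj {0..\<omega>} x = x}"])
  have B: "{0..\<omega>} \<in> sets borel" by simp
  show "subspace {x. proj {0..\<omega>} x = x}"
    using linear_proj[OF B] by (auto simp: subspace_def linear_0 linear_add linear_scale)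
  fix y assume y: "y \<in> {x. proj {0..\<omega>} x = x}"
  then have yP: "proj {0..\<omega>} y = y" by simp
  have yL2: "y \<in> L2_space V" using proj_in_L2_space[OF B, of y] yP by simp
  show "op y \<in> {x. proj {0..\<omega>} x = x}" using proj_op_invariant[OF B yP] by simp
  show "0 \<le> inner (op y) y"
    using nonneg_selfadjoint_ell2_operator[OF T] by (simp add: nonneg_selfadjoint_def)
  have U: "UNIV \<in> sets (borel :: real measure)" by simp
  have mass: "emeasure (meas y) UNIV = ennreal ((norm y)\<^sup>2)"
    unfolding emeasure_scalar_measure[OF pvm yL2 U] ell2_projection_UNIV[OF pvm yL2]
    by (simp add: power2_norm_eq_inner)
  interpret finite_measure "meas y"
    by standard (simp add: mass)
  have "inner (op y) y = (\<integral>t. indicator {0..\<omega>} t * t \<partial>meas y)"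
    using quadratic_form_integral(2)[OF yL2] integral_density_indicator[OF yL2 B]
      scalar_measure_projection(1)[OF pvm yL2 B]
    unfolding yP by simp
  also have "\<dots> \<le> (\<integral>t. \<omega> \<partial>meas y)"
    by (intro integral_mono integrable_indicator_times yL2 B)
       (use \<omega> in \<open>auto split: split_indicator\<close>)
  also have "\<dots> = \<omega> * (norm y)\<^sup>2"
    using mass by (simp add: measure_def)
  finally show "inner (op y) y \<le> \<omega> * (norm y)\<^sup>2" .
qed (use \<omega> x in \<open>auto simp: linear_op selfadjoint_op\<close>)

lemma norm_op_power_le:
  assumes \<omega>: "\<omega> > 0" and x: "proj {0..\<omega>} x = x"
  shows "norm ((op ^^ k) x) \<le> \<omega> ^ k * norm x"
proof -
  have "proj {0..\<omega>} ((op ^^ k) x) = (op ^^ k) x \<and> norm ((op ^^ k) x) \<le> \<omega> ^ k * norm x"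
  proof (induction k)
    case (Suc k)
    have "norm (op ((op ^^ k) x)) \<le> \<omega> * (\<omega> ^ k * norm x)"
      using norm_op_le[OF \<omega>, of "(op ^^ k) x"] Suc \<omega>
      by (meson less_imp_le mult_left_mono order_trans)
    then show ?case using proj_op_invariant[of "{0..\<omega>}" "(op ^^ k) x"] Suc by (simp add: mult.assoc)
  qed (simp add: x)
  then show ?thesis by simp
qed

end

text \<open>Bernstein's inequality for whole powers of \<open>T\<close>, the form in which the
  duality argument meets it: the \<open>2 * k\<close>-th iterate of the root is the
  \<open>k\<close>-th iterate of \<open>T\<close>.\<close>

lemma paley_wiener_bernstein:
  assumes T: "nonneg_selfadjoint_operator V T" and \<omega>: "\<omega> > 0" and f: "f \<in> paley_wiener V T \<omega>"
  shows "f \<in> L2 V"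
    and "norm ((ell2_operator V T ^^ k) (ell2_of f)) \<le> \<omega> ^ k * norm (ell2_of f)"
proof -
  obtain E h where E: "spectral_measure V T E" and h: "h \<in> L2 V" and fh: "f = E {0..\<omega>} h"
    using f by (auto simp: paley_wiener_def)
  interpret spectral_operator V T E using T E by unfold_locales
  have B: "{0..\<omega>} \<in> sets borel" by simp
  note bounded = bounded_operator_projection(1)[OF pvm B]
  show "f \<in> L2 V" unfolding fh by (rule bounded_operator_in_L2[OF bounded h])
  have f_proj: "ell2_of f = proj {0..\<omega>} (ell2_of h)"
    unfolding fh ell2_operator_of[OF bounded h] ..
  show "norm ((op ^^ k) (ell2_of f)) \<le> \<omega> ^ k * norm (ell2_of f)"
    unfolding f_proj by (rule norm_op_power_le[OF \<omega> proj_idem[OF B]])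
qed

section \<open>Variational splines\<close>

lemma half_power_ell2:
  assumes T: "nonneg_selfadjoint_operator V T" and g: "g \<in> L2 V"
  shows "half_power V T k g \<in> L2 V"
    and "ell2_of (half_power V T k g) = (ell2_operator V (operator_sqrt V T) ^^ k) (ell2_of g)"
proof -
  have b: "bounded_operator V (operator_sqrt V T)"
    using operator_sqrt(1)[OF T] by (simp add: nonneg_selfadjoint_operator_def selfadjoint_operator_def)
  have "half_power V T k g \<in> L2 V \<and>
    ell2_of (half_power V T k g) = (ell2_operator V (operator_sqrt V T) ^^ k) (ell2_of g)"
    unfolding half_power_def
    by (induction k) (auto simp: g bounded_operator_in_L2[OF b] simp flip: ell2_operator_of[OF b])
  then show "half_power V T k g \<in> L2 V"
    "ell2_of (half_power V T k g) = (ell2_operator V (operator_sqrt V T) ^^ k) (ell2_of g)"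
    by auto
qed

lemma ell2_operator_sqrt:
  assumes T: "nonneg_selfadjoint_operator V T"
  defines "R \<equiv> ell2_operator V (operator_sqrt V T)"
  shows "selfadjoint R" "R (R x) = ell2_operator V T x"
    "(R ^^ (2 * k)) x = (ell2_operator V T ^^ k) x"
proof -
  have s: "selfadjoint_operator V (operator_sqrt V T)"
    using operator_sqrt(1)[OF T] by (simp add: nonneg_selfadjoint_operator_def)
  then have b: "bounded_operator V (operator_sqrt V T)" by (simp add: selfadjoint_operator_def)
  show "selfadjoint R" unfolding R_def by (rule selfadjoint_ell2_operator[OF s])
  have RR: "R (R x) = ell2_operator V T x" for x
  proof -
    let ?f = "ell2_apply (ell2_restrict V x)"
    have f: "?f \<in> L2 V" by (simp flip: L2_space_iff)
    have "R x = ell2_of (operator_sqrt V T ?f)" by (simp add: R_def ell2_operator_def)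
    then have "R (R x) = ell2_of (operator_sqrt V T (operator_sqrt V T ?f))"
      unfolding R_def using ell2_operator_of[OF b bounded_operator_in_L2[OF b f]] by simp
    then show ?thesis using operator_sqrt(2)[OF T] f by (simp add: ell2_operator_def)
  qed
  then show "R (R x) = ell2_operator V T x" .
  show "(R ^^ (2 * k)) x = (ell2_operator V T ^^ k) x"
    by (induction k) (simp_all add: RR)
qed

text \<open>The directions that leave the data unchanged: the interpolants of \<open>f\<close> form
  the affine space of \<open>f\<close> over it.\<close>

definition zero_average_space :: "'v set \<Rightarrow> 'v set set \<Rightarrow> 'v ell2 set" where
  "zero_average_space V \<Xi> = {x \<in> L2_space V. \<forall>\<Omega>\<in>\<Xi>. (\<Sum>v\<in>\<Omega>. ell2_apply x v) = 0}"

lemma subspace_zero_average_space: "subspace (zero_average_space V \<Xi>)"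
  using subspace_L2_space[of V]
  by (auto simp: subspace_def zero_average_space_def sum.distrib simp flip: scaleR_sum_right)

lemma closed_zero_average_space: "closed (zero_average_space V \<Xi>)"
proof -
  have cont: "continuous_on UNIV (\<lambda>x. ell2_apply x v)" for v :: 'v
    by (rule linear_continuous_on[OF bounded_linear_ell2_apply])
  have "zero_average_space V \<Xi> = (\<Inter>v\<in>- V. {x. ell2_apply x v = 0}) \<inter>
      (\<Inter>\<Omega>\<in>\<Xi>. {x. (\<Sum>v\<in>\<Omega>. ell2_apply x v) = 0})"
    by (auto simp: zero_average_space_def L2_space_def)
  also have "closed \<dots>"
    by (intro closed_Int closed_INT ballI closed_Collect_eq continuous_on_sum cont continuous_on_const)
  finally show ?thesis .
qed

lemma L2_inner_normalized_indicator:
  assumes \<Omega>: "finite \<Omega>" "\<Omega> \<subseteq> V"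
  shows "L2_inner V u (normalized_indicator \<Omega>)
    = complex_of_real (real (card \<Omega>) powr (-1/2)) * (\<Sum>v\<in>\<Omega>. u v)"
proof -
  have "L2_inner V u (normalized_indicator \<Omega>)
      = (\<Sum>\<^sub>\<infinity>v\<in>\<Omega>. u v * cnj (normalized_indicator \<Omega> v))"
    unfolding L2_inner_def
    by (rule infsum_cong_neutral) (use \<Omega> in \<open>auto simp: normalized_indicator_def\<close>)
  also have "\<dots> = (\<Sum>v\<in>\<Omega>. complex_of_real (real (card \<Omega>) powr (-1/2)) * u v)"
    using \<Omega> by (simp add: normalized_indicator_def mult.commute)
  finally show ?thesis by (simp add: sum_distrib_left)
qed

lemma interpolates_iff:
  assumes part: "partition_on V \<Xi>" and parts: "\<And>\<Omega>. \<Omega> \<in> \<Xi> \<Longrightarrow> finite \<Omega>" and f: "f \<in> L2 V"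
  shows "interpolates V \<Xi> f u \<longleftrightarrow> u \<in> L2 V \<and> ell2_of u - ell2_of f \<in> zero_average_space V \<Xi>"
proof (cases "u \<in> L2 V")
  case u: True
  have "L2_inner V u (normalized_indicator \<Omega>) = L2_inner V f (normalized_indicator \<Omega>)
      \<longleftrightarrow> (\<Sum>v\<in>\<Omega>. u v - f v) = 0" if \<Omega>: "\<Omega> \<in> \<Xi>" for \<Omega>
  proof -
    have "\<Omega> \<subseteq> V" "\<Omega> \<noteq> {}" using part \<Omega> by (auto simp: partition_on_def)
    then have "card \<Omega> \<noteq> 0" using parts[OF \<Omega>] by simp
    then show ?thesis
      using L2_inner_normalized_indicator[OF parts[OF \<Omega>] \<open>\<Omega> \<subseteq> V\<close>]
      by (simp add: sum_subtractf)
  qed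
  moreover have "ell2_of u - ell2_of f \<in> L2_space V"
    using u f by (intro subspace_diff subspace_L2_space ell2_of_in_L2_space)
  ultimately show ?thesis
    using u f by (simp add: interpolates_def zero_average_space_def L2_square_summable)
qed (simp add: interpolates_def)

section \<open>Existence of the splines, error estimate and convergence\<close>

theorem theorem10p3:
  fixes V :: "'v set" and w :: "'v \<Rightarrow> 'v \<Rightarrow> real" and \<Xi> :: "'v set set"
    and \<alpha> \<omega> \<Lambda> \<gamma> :: real and f :: "'v \<Rightarrow> complex"
  assumes "weighted_graph V w" and "countable V" and "graph_connected V w"
    and "infinite V \<Longrightarrow> bounded_degrees V w"
    and "partition_on V \<Xi>"
    and "\<And>\<Omega>. \<Omega> \<in> \<Xi> \<Longrightarrow> finite \<Omega> \<and> card \<Omega> > 1 \<and> graph_connected \<Omega> w"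
    and "\<Lambda> = (INF \<Omega>\<in>\<Xi>. first_nonzero_eigenvalue \<Omega> w)" and "\<Lambda> > 0"
    and "\<alpha> > 0" and "\<omega> > 0"
    and "\<gamma> = (1 + \<alpha>) / \<alpha> * (\<omega> / \<Lambda>)" and "\<gamma> < 1"
    and "f \<in> paley_wiener V (laplacian V w) \<omega>"
  shows "L2_tendsto V (\<lambda>l. variational_spline V w \<Xi> (2 ^ l) f) f \<and>
    (\<forall>l. L2_norm V (\<lambda>v. f v - variational_spline V w \<Xi> (2 ^ l) f v)
           \<le> 2 * \<gamma> ^ (2 ^ l) * L2_norm V f)"
proof -
  note w = assms(1) and part = assms(5) and parts = assms(6)
  let ?L = "laplacian V w" and ?N = "zero_average_space V \<Xi>"
  have "bounded_degrees V w" using assms(4) finite_imp_bounded_degrees by blast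
  then obtain c where "bounded_graph V w c" using bounded_graphI[OF w] by blast
  then interpret bounded_graph V w c .
  note L = nonneg_selfadjoint_laplacian
  note f = paley_wiener_bernstein(1)[OF L \<open>\<omega> > 0\<close> assms(13)]
    and bernstein = paley_wiener_bernstein(2)[OF L \<open>\<omega> > 0\<close> assms(13)]
  define R where "R = ell2_operator V (operator_sqrt V ?L)"
  have sR: "selfadjoint R" and RR: "\<And>x. R (R x) = ell2_operator V ?L x"
    and R2k: "\<And>k x. (R ^^ (2 * k)) x = (ell2_operator V ?L ^^ k) x"
    unfolding R_def using ell2_operator_sqrt[OF L] by blast+
  have \<Lambda>_le: "\<Lambda> \<le> first_nonzero_eigenvalue \<Omega> w" if "\<Omega> \<in> \<Xi>" for \<Omega>
  proof -
    \<comment> \<open>A real infimum lies below its members only if the set is bounded below;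
      positivity of every first eigenvalue ensures this.\<close>
    have "0 \<le> first_nonzero_eigenvalue \<Omega> w" if \<Omega>: "\<Omega> \<in> \<Xi>" for \<Omega>
    proof -
      have "weighted_graph \<Omega> w"
        using w partition_onD1[OF part] \<Omega> by (auto simp: weighted_graph_def)
      then show ?thesis using poincare_finite_graph(1)[of \<Omega> w] parts[OF \<Omega>] by (simp add: less_imp_le)
    qed
    then have "bdd_below ((\<lambda>\<Omega>. first_nonzero_eigenvalue \<Omega> w) ` \<Xi>)"
      by (intro bdd_belowI2[where m = 0])
    then show ?thesis unfolding assms(7) using that by (rule cINF_lower)
  qed
  have coercive1: "norm x \<le> (1 / sqrt \<Lambda>) * norm (R x)" if x: "x \<in> ?N" for x
  proof -
    have xL2: "x \<in> L2_space V" using x by (simp add: zero_average_space_def)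
    have "\<Lambda> * (norm x)\<^sup>2 \<le> energy (ell2_apply x) / 2"
      using poincare_partition[OF w part parts \<open>\<Lambda> > 0\<close> \<Lambda>_le, of "ell2_apply x"] x
      by (simp add: zero_average_space_def L2_space_iff ell2_apply_inverse)
    also have "\<dots> = (norm (R x))\<^sup>2"
      using sR by (simp add: inner_ell2_laplacian[OF xL2, symmetric] RR[symmetric]
          power2_norm_eq_inner selfadjoint_def)
    finally have "(sqrt \<Lambda> * norm x)\<^sup>2 \<le> (norm (R x))\<^sup>2"
      using \<open>\<Lambda> > 0\<close> by (simp add: power_mult_distrib)
    then have "sqrt \<Lambda> * norm x \<le> norm (R x)" by (rule power2_le_imp_le) simp
    then show ?thesis using \<open>\<Lambda> > 0\<close> by (simp add: field_simps)
  qed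
  have coercive: "norm x \<le> (1 / sqrt \<Lambda>) ^ (2 ^ l) * norm ((R ^^ (2 ^ l)) x)" if "x \<in> ?N" for x l
    by (rule norm_le_power_two_iterate[OF sR _ coercive1[OF that]]) (use \<open>\<Lambda> > 0\<close> in simp)
  have interp: "interpolates V \<Xi> f u \<longleftrightarrow> u \<in> L2 V \<and> ell2_of u - ell2_of f \<in> ?N" for u
    by (rule interpolates_iff[OF part _ f]) (use parts in blast)
  have spline: "variational_spline V w \<Xi> (2 ^ l) f \<in> L2 V \<and>
      norm (ell2_of f - ell2_of (variational_spline V w \<Xi> (2 ^ l) f)) \<le> (\<omega> / \<Lambda>) ^ (2 ^ l) * norm (ell2_of f)"
    for l
  proof -
    let ?k = "2 ^ l :: nat"
    have half: "L2_norm V (half_power V ?L ?k g) = norm ((R ^^ ?k) (ell2_of g))" if "g \<in> L2 V" for g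
      unfolding R_def using half_power_ell2[OF L that] by (simp add: L2_norm_eq_norm)
    have is_spline: "is_variational_spline V w \<Xi> ?k f g \<longleftrightarrow> g \<in> L2 V \<and>
        ell2_of g - ell2_of f \<in> ?N \<and>
        (\<forall>u. u - ell2_of f \<in> ?N \<longrightarrow> norm ((R ^^ ?k) (ell2_of g)) \<le> norm ((R ^^ ?k) u))" for g
    proof -
      \<comment> \<open>Passes from competing functions to competing vectors. A vector in the affine
        space over \<open>?N\<close> automatically vanishes outside \<open>V\<close>, so it comes
        from an admissible function.\<close>
      have quant: "(\<forall>u. interpolates V \<Xi> f u \<longrightarrow> P (ell2_of u)) \<longleftrightarrow> (\<forall>u. u - ell2_of f \<in> ?N \<longrightarrow> P u)" for P
      proof -
        have "interpolates V \<Xi> f (ell2_apply u)" if u: "u - ell2_of f \<in> ?N" for u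
        proof -
          have "(u - ell2_of f) + ell2_of f \<in> L2_space V"
            using u f by (intro subspace_add subspace_L2_space ell2_of_in_L2_space)
              (simp_all add: zero_average_space_def)
          then show ?thesis
            using u by (simp add: interp L2_space_iff ell2_apply_inverse)
        qed
        note of_zero_average = this
        show ?thesis
        proof (intro iffI allI impI)
          fix u assume "\<forall>u. interpolates V \<Xi> f u \<longrightarrow> P (ell2_of u)" and "u - ell2_of f \<in> ?N"
          then have "P (ell2_of (ell2_apply u))" using of_zero_average by blast
          then show "P u" by (simp add: ell2_apply_inverse)
        next
          fix u assume "\<forall>u. u - ell2_of f \<in> ?N \<longrightarrow> P u" and "interpolates V \<Xi> f u"
          then show "P (ell2_of u)" using interp by blast
        qed
      qed
      have "is_variational_spline V w \<Xi> ?k f g \<longleftrightarrow> interpolates V \<Xi> f g \<and>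
          (\<forall>u. interpolates V \<Xi> f u \<longrightarrow> norm ((R ^^ ?k) (ell2_of g)) \<le> norm ((R ^^ ?k) (ell2_of u)))"
        unfolding is_variational_spline_def
      proof (intro conj_cong refl iff_allI imp_cong)
        fix u assume "interpolates V \<Xi> f g" "interpolates V \<Xi> f u"
        then have "g \<in> L2 V" "u \<in> L2 V" unfolding interp by blast+
        then show "L2_norm V (half_power V ?L ?k g) \<le> L2_norm V (half_power V ?L ?k u)
            \<longleftrightarrow> norm ((R ^^ ?k) (ell2_of g)) \<le> norm ((R ^^ ?k) (ell2_of u))"
          by (simp only: half)
      qed
      then show ?thesis 
        unfolding quant[of "\<lambda>u. norm ((R ^^ ?k) (ell2_of g)) \<le> norm ((R ^^ ?k) u)"]
        unfolding interp by (simp only: conj_assoc)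
    qed
    have blR: "bounded_linear (R ^^ ?k)"
      using sR bounded_linear_funpow by (auto simp: selfadjoint_def)
    obtain s where s: "s - ell2_of f \<in> ?N"
      and min: "\<And>u. u - ell2_of f \<in> ?N \<Longrightarrow> norm ((R ^^ ?k) s) \<le> norm ((R ^^ ?k) u)"
      and uniq: "\<And>s'. s' - ell2_of f \<in> ?N \<Longrightarrow>
        (\<And>u. u - ell2_of f \<in> ?N \<Longrightarrow> norm ((R ^^ ?k) s') \<le> norm ((R ^^ ?k) u)) \<Longrightarrow> s' = s"
      using ex1_minimal_norm_on_affine[OF blR subspace_zero_average_space closed_zero_average_space coercive,
          of V \<Xi> "ell2_of f"]
      by blast
    have "(s - ell2_of f) + ell2_of f \<in> L2_space V"
      using s f by (intro subspace_add subspace_L2_space ell2_of_in_L2_space)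
        (simp_all add: zero_average_space_def)
    then have sL2: "ell2_apply s \<in> L2 V" by (simp add: L2_space_iff)
    \<comment> \<open>The definite description asks for uniqueness among functions; splines lie in
      \<open>L2 V\<close>, where \<open>ell2_of\<close> is injective.\<close>
    have "variational_spline V w \<Xi> ?k f = ell2_apply s"
      unfolding variational_spline_def
    proof (rule the_equality)
      show "is_variational_spline V w \<Xi> ?k f (ell2_apply s)"
        unfolding is_spline ell2_apply_inverse using sL2 s min by blast
      fix g assume "is_variational_spline V w \<Xi> ?k f g"
      then have g: "g \<in> L2 V" "ell2_of g = s" unfolding is_spline using uniq by blast+
      then show "g = ell2_apply s" by (metis ell2_apply_ell2_of L2_square_summable)
    qed
    \<comment> \<open>The coercivity constant enters squared, once for each factor of the squared
      error, which turns the root of \<Lambda> into \<Lambda> itself.\<close>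
    moreover have "norm (ell2_of f - s) \<le> ((1 / sqrt \<Lambda>) ^ ?k)\<^sup>2 * \<omega> ^ ?k * norm (ell2_of f)"
      using bernstein[of ?k] \<open>\<Lambda> > 0\<close>
      by (intro minimal_norm_error[OF sR subspace_zero_average_space s min _ coercive])
         (simp_all add: R2k)
    moreover have "((1 / sqrt \<Lambda>) ^ ?k)\<^sup>2 * \<omega> ^ ?k = (\<omega> / \<Lambda>) ^ ?k"
    proof -
      have "((1 / sqrt \<Lambda>) ^ ?k)\<^sup>2 = ((1 / sqrt \<Lambda>)\<^sup>2) ^ ?k"
        by (simp only: power_mult[symmetric] mult.commute)
      also have "(1 / sqrt \<Lambda>)\<^sup>2 = 1 / \<Lambda>" using \<open>\<Lambda> > 0\<close> by (simp add: power_divide)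
      finally show ?thesis by (simp add: power_divide)
    qed
    ultimately show ?thesis using sL2 by (simp add: ell2_apply_inverse)
  qed
  have \<gamma>: "0 < \<gamma>" "\<omega> / \<Lambda> \<le> \<gamma>"
  proof -
    have pos: "0 < \<omega> / \<Lambda>" using \<open>\<omega> > 0\<close> \<open>\<Lambda> > 0\<close> by simp
    \<comment> \<open>The estimate so far has ratio \<omega> / \<Lambda>; it passes to \<gamma>
      because \<open>(1 + \<alpha>) / \<alpha>\<close> is at least 1.\<close>
    have "1 * (\<omega> / \<Lambda>) \<le> (1 + \<alpha>) / \<alpha> * (\<omega> / \<Lambda>)"
      by (intro mult_right_mono) (use \<open>\<alpha> > 0\<close> pos in \<open>simp_all add: field_simps\<close>)
    then show "\<omega> / \<Lambda> \<le> \<gamma>" "0 < \<gamma>" unfolding assms(11) using pos by simp_all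
  qed
  have error: "L2_norm V (\<lambda>v. f v - variational_spline V w \<Xi> (2 ^ l) f v)
      \<le> 2 * \<gamma> ^ (2 ^ l) * L2_norm V f" for l
  proof -
    let ?s = "variational_spline V w \<Xi> (2 ^ l) f"
    have s: "?s \<in> L2 V" using spline by blast
    have d: "(\<lambda>v. f v - ?s v) \<in> L2 V" using f s by (auto simp: L2_iff intro: square_summable_diff)
    have "ell2_of (\<lambda>v. f v - ?s v) = ell2_of f - ell2_of ?s"
      using f s by (simp add: minus_ell2_def L2_square_summable)
    then have "L2_norm V (\<lambda>v. f v - ?s v) \<le> (\<omega> / \<Lambda>) ^ (2 ^ l) * norm (ell2_of f)"
      using spline[of l] by (simp add: L2_norm_eq_norm[OF d])
    also have "\<dots> \<le> (2 * \<gamma> ^ (2 ^ l)) * norm (ell2_of f)"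
    proof (rule mult_right_mono)
      have "(\<omega> / \<Lambda>) ^ (2 ^ l) \<le> \<gamma> ^ (2 ^ l)"
        using \<gamma>(2) \<open>\<omega> > 0\<close> \<open>\<Lambda> > 0\<close> by (intro power_mono) simp_all
      also have "\<dots> \<le> 2 * \<gamma> ^ (2 ^ l)" using \<gamma>(1) by simp
      finally show "(\<omega> / \<Lambda>) ^ (2 ^ l) \<le> 2 * \<gamma> ^ (2 ^ l)" .
    qed simp
    finally show ?thesis by (simp add: L2_norm_eq_norm[OF f])
  qed
  have "(\<lambda>l. L2_norm V (\<lambda>v. f v - variational_spline V w \<Xi> (2 ^ l) f v)) \<longlonglongrightarrow> 0"
  proof (rule tendsto_sandwich[where f = "\<lambda>_. 0" and h = "\<lambda>l. 2 * \<gamma> ^ (2 ^ l) * L2_norm V f"])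
    have "(\<lambda>k. \<gamma> ^ k) \<longlonglongrightarrow> 0"
      using \<gamma>(1) \<open>\<gamma> < 1\<close> by (intro LIMSEQ_realpow_zero) simp_all
    moreover have "strict_mono (\<lambda>l. 2 ^ l :: nat)" by (auto intro: strict_monoI)
    ultimately have "((\<lambda>k. \<gamma> ^ k) \<circ> (\<lambda>l. 2 ^ l)) \<longlonglongrightarrow> 0" by (rule LIMSEQ_subseq_LIMSEQ)
    then have "(\<lambda>l. \<gamma> ^ (2 ^ l)) \<longlonglongrightarrow> 0" by (simp only: o_def)
    then have "(\<lambda>l. 2 * \<gamma> ^ (2 ^ l) * L2_norm V f) \<longlonglongrightarrow> 2 * 0 * L2_norm V f"
      by (intro tendsto_mult tendsto_const)
    then show "(\<lambda>l. 2 * \<gamma> ^ (2 ^ l) * L2_norm V f) \<longlonglongrightarrow> 0" by simp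
    show "\<forall>\<^sub>F l in sequentially. 0 \<le> L2_norm V (\<lambda>v. f v - variational_spline V w \<Xi> (2 ^ l) f v)"
      by (simp add: L2_norm_def infsum_nonneg)
  qed (use error in auto)
  then show ?thesis
    unfolding L2_tendsto_def using f spline error by blast
qed

end
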